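(* Let $(X,f)$ be a Deaconu--Renault system such that $D:=\operatorname{Dom}(f)$ is an infinite locally compact Hausdorff space admitting a countable basis $\mathcal B$ of compact open sets closed under finite intersections, and such that $D\subseteq f(D)\subseteq D^\infty$, where $D^\infty=D\cup\{\infty\}$ is the one-point compactification of $D$. Let $(E,\alpha_f)$ be the associated inverse-limit Deaconu--Renault system (defined in the context), and assume that $\vec 0\in E$. Fix a compatible ultrametric $d_\infty$ on $D^\infty$, and suppose that $(X,f)$ satisfies the separation property on $D^\infty$ with respect to $d_\infty$ (defined in the context). Then $(E,\alpha_f)$ has the shadowing property if and only if $(D^\infty,f)$, with $\operatorname{Dom}(f)=D$, has the shadowing property.
   Context: Conventions: $\mathbb N=\{1,2,\dots\}$. A Deaconu--Renault system is a pair $(X,f)$ where $X$ is a locally compact Hausdorff space and $f:\operatorname{Dom}(f)\to\operatorname{Im}(f)$ is a local homeomorphism (onto $\operatorname{Im}(f)$), with $\operatorname{Dom}(f),\operatorname{Im}(f)$ open subsets of $X$. Write $D=\operatorname{Dom}(f)$. The one-point compactification is $D^\infty=D\cup\{\infty\}$, whose open sets are the open subsets of $D$ and the complements of compact subsets of $D$. The condition $f(D)\subseteq D^\infty$ means that $f(D)$ is regarded as a subspace of $D^\infty$ (a point of $f(D)$ outside $D$, if any, is identified with $\infty$), so that $f$ is also viewed as a partially defined map on $D^\infty$ with domain $D$. The space $D_0$. Let $D^{0}=\{\vec 0\}$ (empty word) and let $D_0=D^{\mathbb N}\cup\bigcup_{n\ge 0}D^n$ be the set of finite and infinite words $x=x_1x_2\cdots$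 in $D$; $\ell(x)\in\{0,1,2,\dots\}\cup\{\infty\}$ is the length. Let $Q:(D^\infty)^{\mathbb N}\to D_0$ send $(x_1,x_2,\dots)$ to the infinite word $x_1x_2\cdots$ if no $x_i=\infty$, and otherwise to $x_1\cdots x_n$ where $n+1$ is the first index with $x_{n+1}=\infty$ ($\vec 0$ if $x_1=\infty$). $D_0$ has the quotient topology induced by $Q$ from the product topology. Metric on $D_0$. Let $\mathcal P=\bigcup_{n\ge1}\mathcal B^n=\{p_1,p_2,\dots\}$ be a fixed enumeration, with $(B_1,\dots,B_k)\in\mathcal B^k$ written $B_1\times\cdots\times B_k$, and let $Z[B_1\times\cdots\times B_k,\emptyset]=\{x\in D_0:\ell(x)\ge k,\ x_i\in B_i \text{ for } 1\le i\le k\}$. For $x\ne y$ in $D_0$ put $d(x,y)=2^{-i}$, where $i$ is the smallest index such that exactly one of $x,y$ belongs to $Z[p_i,\emptyset]$; $d(x,x)=0$. This is a metric compatible with the topology of $D_0$; subspaces of $D_0$ carry the restriction of $d$. Inverse limit. A word $x$ of positive length is a backward $f$-path if $f(x_{i+1})=x_i$ for all $1\le i<\ell(x)$. Let $D_\infty$ be the set of infinite backward $f$-paths in $D_0$; let $D_{\mathrm{fin}}$ be the set of backward $f$-paths of finite positive length together with $\vec 0$; let $D_{\mathrm{lim}}$ be the set of $x\in D_{\mathrm{fin}}$ which are limits in $D_0$ of sequences from $D_\infty$. Set $\widetilde X=D_\infty\cup D_{\mathrm{lim}}$, with the subspace topology. Let $\operatorname{Dom}(\sigma)=\{x\in\widetilde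 X:\ell(x)\ge1\}$ and let $\sigma:\operatorname{Dom}(\sigma)\to\widetilde X$ delete the first letter ($\sigma(x)=\vec 0$ if $\ell(x)=1$). Set $E=\sigma(\operatorname{Dom}(\sigma))\subseteq\widetilde X$, and let $\alpha_f$ be the partially defined map on $E$ with domain $E\setminus\{\vec 0\}$ given by $\alpha_f(y_1y_2\cdots)=f(y_1)y_1y_2\cdots$. The pair $(E,\alpha_f)$ is the associated Deaconu--Renault system, with metric $d$ restricted to $E$. Shadowing. Let $(Y,g)$ be a Deaconu--Renault system with $Y$ a metric space with metric $\rho$. For $\delta>0$, a $\delta$-pseudo-orbit is a sequence $(x_n)_{n\ge0}$ in $\operatorname{Dom}(g)$ with $\rho(g(x_n),x_{n+1})<\delta$ for all $n\ge 0$. A point $z$ $\varepsilon$-shadows $(x_n)$ if $z\in\operatorname{Dom}(g^n)$ and $\rho(g^n(z),x_n)<\varepsilon$ for all $n\ge0$. $(Y,g)$ has the shadowing property if for every $\varepsilon>0$ there is $\delta>0$ such that every $\delta$-pseudo-orbit in $\operatorname{Dom}(g)$ is $\varepsilon$-shadowed by some $z\in\operatorname{Dom}(g)$. For $(D^\infty,f)$ use $d_\infty$; for $(E,\alpha_f)$ use $d$. Separation property. $(X,f)$ satisfies the separation property on $D^\infty$ with respect to $d_\infty$ (whose restriction to $D$ is also denoted $d_\infty$) if there exist $R>0$, $0<\theta<1$, and a countable family $\{W_r\}_{r\in\mathbb N}\subseteq\mathcal B$ covering $D$ such that for every $r$: (A1) $f|_{W_r}:W_r\to f(W_r)$ is a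 homeomorphism onto its image and $f(W_r)\subseteq D^\infty$; let $g_r=(f|_{W_r})^{-1}:f(W_r)\to W_r$; (A2) $d_\infty(g_r(a),g_r(b))\le\theta\, d_\infty(a,b)$ for all $a,b\in f(W_r)$; (A3) for every $y\in f(W_r)$ the open ball $B_{D^\infty}(y,R)=\{u\in D^\infty:d_\infty(y,u)<R\}$ is contained in $f(W_r)$. *)

theory Defs
  imports "HOL-Analysis.Analysis"
begin

section \<open>Deaconu--Renault systems and the one-point compactification\<close>

definition deaconu_renault :: "'a topology \<Rightarrow> 'a set \<Rightarrow> ('a \<Rightarrow> 'a) \<Rightarrow> bool" where
  "deaconu_renault X D f \<longleftrightarrow>
     locally_compact_space X \<and> Hausdorff_space X \<and>
     openin X D \<and> openin X (f ` D) \<and>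
     (\<forall>x\<in>D. \<exists>U. x \<in> U \<and> U \<subseteq> D \<and> openin X U \<and> openin X (f ` U) \<and>
        homeomorphic_map (subtopology X U) (subtopology X (f ` U)) f)"

definition compact_open_basis :: "'a topology \<Rightarrow> 'a set set \<Rightarrow> bool" where
  "compact_open_basis Y \<B> \<longleftrightarrow>
     countable \<B> \<and> (\<forall>V\<in>\<B>. openin Y V \<and> compactin Y V) \<and>
     (\<forall>U x. openin Y U \<and> x \<in> U \<longrightarrow> (\<exists>V\<in>\<B>. x \<in> V \<and> V \<subseteq> U)) \<and>
     (\<forall>\<F>. finite \<F> \<and> \<F> \<noteq> {} \<and> \<F> \<subseteq> \<B> \<longrightarrow> \<Inter>\<F> \<in> \<B>)"

text \<open>The one-point compactification of the subspace \<open>D\<close> of \<open>X\<close>; the point at infinity is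
  \<^const>\<open>None\<close>.\<close>

abbreviation compactified :: "'a topology \<Rightarrow> 'a set \<Rightarrow> 'a option topology" where
  "compactified X D \<equiv> Alexandroff_compactification (subtopology X D)"

text \<open>The identification of a point outside \<open>D\<close> with infinity.\<close>

definition to_cpt :: "'a set \<Rightarrow> 'a \<Rightarrow> 'a option" where
  "to_cpt D x = (if x \<in> D then Some x else None)"

text \<open>\<open>S \<subseteq> D\<^sup>\<infinity>\<close> for a subset \<open>S\<close> of \<open>X\<close>: the identification makes \<open>S\<close>, with its topology as a
  subset of \<open>X\<close>, a subspace of the compactification. In particular at most one point of \<open>S\<close> lies
  outside \<open>D\<close>.\<close>

definition subspace_of_cpt :: "'a topology \<Rightarrow> 'a set \<Rightarrow> 'a set \<Rightarrow> bool" where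
  "subspace_of_cpt X D S \<longleftrightarrow> embedding_map (subtopology X S) (compactified X D) (to_cpt D)"

text \<open>The map \<open>f\<close> viewed as a partial map on the compactification with domain \<open>Some ` D\<close>; its value
  at \<^const>\<open>None\<close> is irrelevant.\<close>

definition on_cpt :: "'a set \<Rightarrow> ('a \<Rightarrow> 'a) \<Rightarrow> 'a option \<Rightarrow> 'a option" where
  "on_cpt D f u = (case u of None \<Rightarrow> None | Some x \<Rightarrow> to_cpt D (f x))"

definition compatible_ultrametric :: "'y topology \<Rightarrow> ('y \<Rightarrow> 'y \<Rightarrow> real) \<Rightarrow> bool" where
  "compatible_ultrametric Y \<rho> \<longleftrightarrow>
     Metric_space (topspace Y) \<rho> \<and> Metric_space.mtopology (topspace Y) \<rho> = Y \<and>
     (\<forall>x\<in>topspace Y. \<forall>y\<in>topspace Y. \<forall>z\<in>topspace Y. \<rho> x z \<le> max (\<rho> x y) (\<rho> y z))"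


section \<open>The space of finite and infinite words\<close>

text \<open>Letters are numbered from \<open>0\<close>, so \<open>letter w i\<close> is \<open>w\<^sub>i\<^sub>+\<^sub>1\<close> in the usual notation. The empty
  word is \<open>FinW []\<close>.\<close>

datatype 'a fiword = FinW "'a list" | InfW "nat \<Rightarrow> 'a"

fun wlen :: "'a fiword \<Rightarrow> enat" where
  "wlen (FinW xs) = enat (length xs)"
| "wlen (InfW s) = \<infinity>"

text \<open>Only meaningful for \<open>enat i < wlen w\<close>.\<close>

fun letter :: "'a fiword \<Rightarrow> nat \<Rightarrow> 'a" where
  "letter (FinW xs) i = xs ! i"
| "letter (InfW s) i = s i"

fun wtl :: "'a fiword \<Rightarrow> 'a fiword" where
  "wtl (FinW xs) = FinW (tl xs)"
| "wtl (InfW s) = InfW (\<lambda>i. s (Suc i))"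

fun wcons :: "'a \<Rightarrow> 'a fiword \<Rightarrow> 'a fiword" where
  "wcons a (FinW xs) = FinW (a # xs)"
| "wcons a (InfW s) = InfW (case_nat a s)"

definition words :: "'a set \<Rightarrow> 'a fiword set" where
  "words D = {w. \<forall>i. enat i < wlen w \<longrightarrow> letter w i \<in> D}"

definition trunc :: "(nat \<Rightarrow> 'a option) \<Rightarrow> 'a fiword" where
  "trunc u = (if \<forall>i. u i \<noteq> None then InfW (\<lambda>i. the (u i))
              else FinW (map (\<lambda>i. the (u i)) [0..<(LEAST n. u n = None)]))"

definition cpt_seqs :: "'a topology \<Rightarrow> 'a set \<Rightarrow> (nat \<Rightarrow> 'a option) topology" where
  "cpt_seqs X D = product_topology (\<lambda>_. compactified X D) UNIV"

text \<open>The quotient topology on \<open>words D\<close> induced by \<^const>\<open>trunc\<close>;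
  see \<open>quotient_map_trunc\<close> below.\<close>

definition word_top :: "'a topology \<Rightarrow> 'a set \<Rightarrow> 'a fiword topology" where
  "word_top X D = topology (\<lambda>U. U \<subseteq> trunc ` topspace (cpt_seqs X D) \<and>
     openin (cpt_seqs X D) {u \<in> topspace (cpt_seqs X D). trunc u \<in> U})"

lemma openin_word_top:
  "openin (word_top X D) U \<longleftrightarrow> U \<subseteq> trunc ` topspace (cpt_seqs X D) \<and>
     openin (cpt_seqs X D) {u \<in> topspace (cpt_seqs X D). trunc u \<in> U}"
proof -
  let ?T = "cpt_seqs X D"
  have "istopology (\<lambda>U. U \<subseteq> trunc ` topspace ?T \<and> openin ?T {u \<in> topspace ?T. trunc u \<in> U})"
    unfolding istopology_def
  proof (intro conjI allI impI; (elim conjE)?)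
    fix S T :: "'a fiword set"
    assume "openin ?T {u \<in> topspace ?T. trunc u \<in> S}" "openin ?T {u \<in> topspace ?T. trunc u \<in> T}"
    then have "openin ?T ({u \<in> topspace ?T. trunc u \<in> S} \<inter> {u \<in> topspace ?T. trunc u \<in> T})"
      by (rule openin_Int)
    moreover have "{u \<in> topspace ?T. trunc u \<in> S} \<inter> {u \<in> topspace ?T. trunc u \<in> T}
        = {u \<in> topspace ?T. trunc u \<in> S \<inter> T}" by blast
    ultimately show "openin ?T {u \<in> topspace ?T. trunc u \<in> S \<inter> T}" by simp
  next
    fix K :: "'a fiword set set"
    assume K: "\<forall>S\<in>K. S \<subseteq> trunc ` topspace ?T \<and> openin ?T {u \<in> topspace ?T. trunc u \<in> S}"
    then have "openin ?T (\<Union>S\<in>K. {u \<in> topspace ?T. trunc u \<in> S})" by blast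
    moreover have "(\<Union>S\<in>K. {u \<in> topspace ?T. trunc u \<in> S}) = {u \<in> topspace ?T. trunc u \<in> \<Union>K}"
      by blast
    ultimately show "openin ?T {u \<in> topspace ?T. trunc u \<in> \<Union>K}" by simp
  qed (blast+)
  then show ?thesis
    by (simp add: word_top_def topology_inverse')
qed

lemma trunc_image_cpt_seqs:
  assumes "D \<subseteq> topspace X"
  shows "trunc ` topspace (cpt_seqs X D) = words D"
proof -
  have ts: "topspace (cpt_seqs X D) = {u. \<forall>i. u i \<in> insert None (Some ` D)}"
    using assms by (auto simp: cpt_seqs_def Int_absorb1 PiE_def Pi_def)
  show ?thesis
  proof (intro equalityI subsetI)
    fix w assume "w \<in> trunc ` topspace (cpt_seqs X D)"
    then obtain u where u: "\<And>i. u i \<in> insert None (Some ` D)" and w: "w = trunc u"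
      by (auto simp: ts)
    have *: "the (u i) \<in> D" if "u i \<noteq> None" for i using u[of i] that by auto
    have "the (u i) \<in> D" if "i < (LEAST n. u n = None)" for i
      using * not_less_Least[OF that] by blast
    then show "w \<in> words D" using * by (auto simp: w words_def trunc_def)
  next
    fix w assume w: "w \<in> words D"
    define u where "u = (\<lambda>i. if enat i < wlen w then Some (letter w i) else None)"
    have "u \<in> topspace (cpt_seqs X D)" using w by (auto simp: ts u_def words_def)
    moreover have "trunc u = w"
    proof (cases w)
      case (FinW xs)
      have "(LEAST n. u n = None) = length xs"
        by (rule Least_equality) (auto simp: u_def FinW split: if_splits)
      moreover have "\<not> (\<forall>i. u i \<noteq> None)" by (auto simp: u_def FinW)
      ultimately show ?thesis
        by (auto simp: trunc_def FinW u_def intro!: nth_equalityI)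
    qed (simp add: trunc_def u_def)
    ultimately show "w \<in> trunc ` topspace (cpt_seqs X D)" by blast
  qed
qed

lemma topspace_word_top:
  assumes "D \<subseteq> topspace X"
  shows "topspace (word_top X D) = words D"
proof -
  have "openin (word_top X D) (words D)"
    unfolding openin_word_top trunc_image_cpt_seqs[OF assms, symmetric]
    by (auto simp: image_iff) (metis (mono_tags, lifting) Collect_cong Collect_mem_eq openin_topspace)
  moreover have "U \<subseteq> words D" if "openin (word_top X D) U" for U
    using that trunc_image_cpt_seqs[OF assms] by (simp add: openin_word_top)
  ultimately show ?thesis
    by (meson openin_subset openin_topspace subset_antisym)
qed

lemma quotient_map_trunc:
  assumes "D \<subseteq> topspace X"
  shows "quotient_map (cpt_seqs X D) (word_top X D) trunc"
  using trunc_image_cpt_seqs[OF assms] topspace_word_top[OF assms]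
  by (simp add: quotient_map_def openin_word_top)


section \<open>The metric on words\<close>

text \<open>An element \<open>(B\<^sub>1, \<dots>, B\<^sub>k)\<close> of some power of the basis, \<open>k \<ge> 1\<close>, is a nonempty list.\<close>

definition basis_tuples :: "'a set set \<Rightarrow> 'a set list set" where
  "basis_tuples \<B> = {bs. bs \<noteq> [] \<and> set bs \<subseteq> \<B>}"

definition cylinder :: "'a set \<Rightarrow> 'a set list \<Rightarrow> 'a fiword set" where
  "cylinder D bs = {w \<in> words D. enat (length bs) \<le> wlen w \<and> (\<forall>i<length bs. letter w i \<in> bs ! i)}"

text \<open>The enumeration \<open>p\<close> is indexed from \<open>1\<close>; \<open>p 0\<close> is not used.\<close>

definition word_dist ::
    "'a set \<Rightarrow> (nat \<Rightarrow> 'a set list) \<Rightarrow> 'a fiword \<Rightarrow> 'a fiword \<Rightarrow> real" where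
  "word_dist D p x y = (if x = y then 0 else
     (1/2) ^ (LEAST i. 1 \<le> i \<and> (x \<in> cylinder D (p i)) \<noteq> (y \<in> cylinder D (p i))))"


section \<open>The inverse limit system\<close>

definition backward_path :: "('a \<Rightarrow> 'a) \<Rightarrow> 'a fiword \<Rightarrow> bool" where
  "backward_path f x \<longleftrightarrow> 1 \<le> wlen x \<and>
     (\<forall>i. enat (Suc i) < wlen x \<longrightarrow> f (letter x (Suc i)) = letter x i)"

definition D_infty :: "'a set \<Rightarrow> ('a \<Rightarrow> 'a) \<Rightarrow> 'a fiword set" where
  "D_infty D f = {x \<in> words D. wlen x = \<infinity> \<and> backward_path f x}"

definition D_fin :: "'a set \<Rightarrow> ('a \<Rightarrow> 'a) \<Rightarrow> 'a fiword set" where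
  "D_fin D f = insert (FinW []) {x \<in> words D. wlen x \<noteq> \<infinity> \<and> backward_path f x}"

definition D_lim :: "'a topology \<Rightarrow> 'a set \<Rightarrow> ('a \<Rightarrow> 'a) \<Rightarrow> 'a fiword set" where
  "D_lim X D f = {x \<in> D_fin D f.
     \<exists>s. (\<forall>n. s n \<in> D_infty D f) \<and> limitin (word_top X D) s x sequentially}"

definition X_tilde :: "'a topology \<Rightarrow> 'a set \<Rightarrow> ('a \<Rightarrow> 'a) \<Rightarrow> 'a fiword set" where
  "X_tilde X D f = D_infty D f \<union> D_lim X D f"

text \<open>The shift is \<^const>\<open>wtl\<close>.\<close>

definition dom_shift :: "'a topology \<Rightarrow> 'a set \<Rightarrow> ('a \<Rightarrow> 'a) \<Rightarrow> 'a fiword set" where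
  "dom_shift X D f = {x \<in> X_tilde X D f. 1 \<le> wlen x}"

definition E_space :: "'a topology \<Rightarrow> 'a set \<Rightarrow> ('a \<Rightarrow> 'a) \<Rightarrow> 'a fiword set" where
  "E_space X D f = wtl ` dom_shift X D f"

text \<open>If \<open>f (letter y 0)\<close> is in \<open>D\<close> but is sent by \<open>f\<close> to infinity, then \<open>alpha f y\<close> is in
  \<^const>\<open>X_tilde\<close> but not in \<^const>\<open>E_space\<close>: the codomain is \<^const>\<open>X_tilde\<close>, on which
  \<^const>\<open>word_dist\<close> is still defined.\<close>

definition alpha :: "('a \<Rightarrow> 'a) \<Rightarrow> 'a fiword \<Rightarrow> 'a fiword" where
  "alpha f y = wcons (f (letter y 0)) y"


section \<open>Shadowing\<close>

text \<open>A partial map \<open>g\<close> on \<open>Y\<close> with domain \<open>A \<subseteq> Y\<close>; \<open>dom_power Y A g n\<close> is the domain of its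
  \<open>n\<close>-th iterate.\<close>

definition dom_power :: "'y set \<Rightarrow> 'y set \<Rightarrow> ('y \<Rightarrow> 'y) \<Rightarrow> nat \<Rightarrow> 'y set" where
  "dom_power Y A g n = {z \<in> Y. \<forall>k<n. (g ^^ k) z \<in> A}"

definition pseudo_orbit ::
    "'y set \<Rightarrow> ('y \<Rightarrow> 'y) \<Rightarrow> ('y \<Rightarrow> 'y \<Rightarrow> real) \<Rightarrow> real \<Rightarrow> (nat \<Rightarrow> 'y) \<Rightarrow> bool" where
  "pseudo_orbit A g \<rho> \<delta> x \<longleftrightarrow> (\<forall>n. x n \<in> A) \<and> (\<forall>n. \<rho> (g (x n)) (x (Suc n)) < \<delta>)"

definition shadows ::
    "'y set \<Rightarrow> 'y set \<Rightarrow> ('y \<Rightarrow> 'y) \<Rightarrow> ('y \<Rightarrow> 'y \<Rightarrow> real) \<Rightarrow> real \<Rightarrow> 'y \<Rightarrow> (nat \<Rightarrow> 'y) \<Rightarrow> bool" where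
  "shadows Y A g \<rho> \<epsilon> z x \<longleftrightarrow> (\<forall>n. z \<in> dom_power Y A g n \<and> \<rho> ((g ^^ n) z) (x n) < \<epsilon>)"

definition shadowing_property ::
    "'y set \<Rightarrow> 'y set \<Rightarrow> ('y \<Rightarrow> 'y) \<Rightarrow> ('y \<Rightarrow> 'y \<Rightarrow> real) \<Rightarrow> bool" where
  "shadowing_property Y A g \<rho> \<longleftrightarrow>
     (\<forall>\<epsilon>>0. \<exists>\<delta>>0. \<forall>x. pseudo_orbit A g \<rho> \<delta> x \<longrightarrow> (\<exists>z\<in>A. shadows Y A g \<rho> \<epsilon> z x))"


section \<open>The separation property\<close>

text \<open>The inverse branches \<open>g\<^sub>r\<close> are taken in the compactification: the image of \<open>W r\<close> there is
  \<open>on_cpt D f ` Some ` W r\<close>.\<close>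

definition separation_property ::
    "'a topology \<Rightarrow> 'a set \<Rightarrow> ('a \<Rightarrow> 'a) \<Rightarrow> 'a set set \<Rightarrow> ('a option \<Rightarrow> 'a option \<Rightarrow> real) \<Rightarrow> bool" where
  "separation_property X D f \<B> d_inf \<longleftrightarrow>
     (\<exists>R \<theta> W. R > 0 \<and> 0 < \<theta> \<and> \<theta> < 1 \<and> (\<forall>r::nat. W r \<in> \<B>) \<and> D \<subseteq> (\<Union>r. W r) \<and>
       (\<forall>r. let F = on_cpt D f; S = Some ` W r; g = inv_into S F in
          homeomorphic_map (subtopology X (W r)) (subtopology X (f ` W r)) f \<and>
          subspace_of_cpt X D (f ` W r) \<and>
          (\<forall>a\<in>F ` S. \<forall>b\<in>F ` S. d_inf (g a) (g b) \<le> \<theta> * d_inf a b) \<and>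
          (\<forall>y\<in>F ` S. Metric_space.mball (topspace (compactified X D)) d_inf y R \<subseteq> F ` S)))"

end

theory Submission
  imports Defs
begin

text \<open>Taking first letters turns a pseudo-orbit of words into one of points. Conversely, since the
  inverse branches of \<open>f\<close> contract and are defined on balls of a fixed radius, a backward path can be
  pulled back along any backward path whose first letter is nearby, without the letters drifting
  apart. A shadowing point of the first letters is thus extended to a word by pulling back along an
  infinite path close to the first word of the pseudo-orbit; the prepended letters are right because
  each word of the pseudo-orbit remembers its predecessors up to the finite depth seen by the metric.
  In the other direction a pseudo-orbit of points, moved so that \<open>f\<close> never reaches infinity, is lifted
  one word at a time by the same pullback.\<close>


section \<open>Cylinders and the word metric\<close>

lemma FinW_in_words [simp]: "FinW xs \<in> words D \<longleftrightarrow> set xs \<subseteq> D"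
  by (auto simp: words_def set_conv_nth)

lemma InfW_in_words [simp]: "InfW s \<in> words D \<longleftrightarrow> (\<forall>i. s i \<in> D)"
  by (auto simp: words_def)

lemma cylinder_Nil [simp]: "cylinder D [] = words D"
  by (auto simp: cylinder_def simp flip: zero_enat_def)

lemma cylinder_subset_words: "cylinder D bs \<subseteq> words D"
  by (auto simp: cylinder_def)

lemma wlen_ge_1_iff: "1 \<le> wlen x \<longleftrightarrow> x \<noteq> FinW []"
  by (cases x) (auto simp: one_enat_def Suc_le_eq)

lemma cylinder_Cons:
  "x \<in> cylinder D (B # bs) \<longleftrightarrow>
     x \<noteq> FinW [] \<and> letter x 0 \<in> D \<inter> B \<and> wtl x \<in> cylinder D bs"
proof (cases x)
  case (FinW xs)
  then show ?thesis
    by (cases xs) (auto simp: cylinder_def All_less_Suc2)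
next
  case (InfW s)
  have "(\<forall>i. s i \<in> D) \<longleftrightarrow> s 0 \<in> D \<and> (\<forall>i. s (Suc i) \<in> D)"
    by (metis not0_implies_Suc)
  then show ?thesis
    by (auto simp: InfW cylinder_def All_less_Suc2)
qed

lemma cylinder_InfW:
  "InfW s \<in> cylinder D bs \<longleftrightarrow> (\<forall>i. s i \<in> D) \<and> (\<forall>i<length bs. s i \<in> bs ! i)"
  by (auto simp: cylinder_def)

text \<open>A stand-in for closeness in the metric: with \<open>F\<close> finite, these relations
  give the same uniform structure as \<open>word_dist\<close>. Unlike the metric they do not depend
  on the enumeration, and deleting a first letter that \<open>F\<close> sees simply costs one unit
  of \<open>k\<close>.\<close>

definition agree :: "'a set \<Rightarrow> 'a set set \<Rightarrow> nat \<Rightarrow> 'a fiword \<Rightarrow> 'a fiword \<Rightarrow> bool" where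
  "agree D F k x y \<longleftrightarrow>
     (\<forall>bs. set bs \<subseteq> F \<and> length bs \<le> k \<longrightarrow> (x \<in> cylinder D bs \<longleftrightarrow> y \<in> cylinder D bs))"

lemma agree_sym: "agree D F k x y \<Longrightarrow> agree D F k y x"
  by (auto simp: agree_def)

lemma agree_trans: "agree D F k x y \<Longrightarrow> agree D F k y z \<Longrightarrow> agree D F k x z"
  by (auto simp: agree_def)

lemma agree_mono: "agree D F k x y \<Longrightarrow> F' \<subseteq> F \<Longrightarrow> k' \<le> k \<Longrightarrow> agree D F' k' x y"
  unfolding agree_def by (meson order_trans)

lemma agree_0: "x \<in> words D \<Longrightarrow> y \<in> words D \<Longrightarrow> agree D F 0 x y"
  by (auto simp: agree_def)

lemma wtl_in_words: "x \<in> words D \<Longrightarrow> wtl x \<in> words D"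
proof (cases x)
  case (FinW xs)
  then show "x \<in> words D \<Longrightarrow> wtl x \<in> words D" by (cases xs) auto
qed simp

lemma letter_0_in: "x \<in> words D \<Longrightarrow> x \<noteq> FinW [] \<Longrightarrow> letter x 0 \<in> D"
  by (cases x) (auto simp: neq_Nil_conv)

text \<open>A cylinder tests the tail only after the first letter has passed its own test. So tails
  have to be compared only for heads that some member of \<open>F\<close> contains.\<close>

lemma agree_Suc_I:
  assumes "x \<in> words D" "y \<in> words D" "x \<noteq> FinW []" "y \<noteq> FinW []"
    and "\<And>B. B \<in> F \<Longrightarrow> letter x 0 \<in> B \<longleftrightarrow> letter y 0 \<in> B"
    and "\<And>B. B \<in> F \<Longrightarrow> letter y 0 \<in> B \<Longrightarrow> agree D F k (wtl x) (wtl y)"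
  shows "agree D F (Suc k) x y"
  unfolding agree_def
proof (intro allI impI)
  fix bs assume bs: "set bs \<subseteq> F \<and> length bs \<le> Suc k"
  show "x \<in> cylinder D bs \<longleftrightarrow> y \<in> cylinder D bs"
  proof (cases bs)
    case Nil
    then show ?thesis using assms by simp
  next
    case (Cons B cs)
    have D: "letter x 0 \<in> D" "letter y 0 \<in> D"
      using letter_0_in assms(1-4) by auto
    have cs: "B \<in> F" "set cs \<subseteq> F" "length cs \<le> k" using bs Cons by auto
    have "wtl x \<in> cylinder D cs \<longleftrightarrow> wtl y \<in> cylinder D cs" if "letter y 0 \<in> B"
      using assms(6)[OF cs(1) that] cs unfolding agree_def by blast
    then show ?thesis
      using assms(3,4) assms(5)[OF cs(1)] D unfolding Cons cylinder_Cons by blast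
  qed
qed

text \<open>Putting \<open>B\<close> in front of a list turns a test of the tail into a test of the
  whole word. A head outside all members of \<open>F\<close> would hide its tail from
  \<open>F\<close>.\<close>

lemma agree_wtl:
  assumes "agree D F (Suc k) x y" "x \<in> words D" "x \<noteq> FinW []" "B \<in> F" "letter x 0 \<in> B"
  shows "agree D F k (wtl x) (wtl y)"
  unfolding agree_def
proof (intro allI impI)
  fix bs assume bs: "set bs \<subseteq> F \<and> length bs \<le> k"
  have "set [B] \<subseteq> F" "length [B] \<le> Suc k" using assms by auto
  then have 1: "x \<in> cylinder D [B] \<longleftrightarrow> y \<in> cylinder D [B]"
    using assms(1) unfolding agree_def by blast
  have "set (B # bs) \<subseteq> F" "length (B # bs) \<le> Suc k" using assms bs by auto
  then have 2: "x \<in> cylinder D (B # bs) \<longleftrightarrow> y \<in> cylinder D (B # bs)"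
    using assms(1) unfolding agree_def by blast
  show "wtl x \<in> cylinder D bs \<longleftrightarrow> wtl y \<in> cylinder D bs"
    using 1 2 assms letter_0_in[of x D] wtl_in_words[of x D] by (auto simp: cylinder_Cons)
qed

lemma agree_nonempty_iff:
  assumes "agree D F (Suc k) x y" "x \<in> words D" "x \<noteq> FinW []" "B \<in> F" "letter x 0 \<in> B"
  shows "y \<noteq> FinW [] \<and> letter y 0 \<in> B"
proof -
  have "set [B] \<subseteq> F" "length [B] \<le> Suc k" using assms by auto
  then have "x \<in> cylinder D [B] \<longleftrightarrow> y \<in> cylinder D [B]"
    using assms(1) unfolding agree_def by blast
  then show ?thesis using assms letter_0_in[of x D] wtl_in_words[of x D]
    by (auto simp: cylinder_Cons)
qed

lemma agree_InfW:
  assumes "\<And>i. s i \<in> D" "\<And>i. t i \<in> D" "\<And>i B. B \<in> F \<Longrightarrow> s i \<in> B \<longleftrightarrow> t i \<in> B"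
  shows "agree D F k (InfW s) (InfW t)"
  unfolding agree_def
proof (intro allI impI)
  fix bs assume "set bs \<subseteq> F \<and> length bs \<le> k"
  then have "bs ! i \<in> F" if "i < length bs" for i using that by auto
  then show "InfW s \<in> cylinder D bs \<longleftrightarrow> InfW t \<in> cylinder D bs"
    using assms by (auto simp: cylinder_InfW)
qed

text \<open>Only finitely many lists are involved. If \<open>N\<close> bounds their indices in the
  enumeration, a distance below \<open>(1/2) ^ N\<close> leaves none of them to separate
  \<open>x\<close> from \<open>y\<close>.\<close>

lemma agree_of_word_dist_less:
  assumes p: "p ` {1..} = basis_tuples \<B>" and F: "finite F" "F \<subseteq> \<B>"
  obtains \<delta> where "\<delta> > 0"
    "\<And>x y. x \<in> words D \<Longrightarrow> y \<in> words D \<Longrightarrow> word_dist D p x y < \<delta> \<Longrightarrow> agree D F k x y"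
proof -
  define L where "L = {bs. set bs \<subseteq> F \<and> length bs \<le> k}"
  have "finite L" using F finite_lists_length_le unfolding L_def by blast
  have "\<exists>i\<ge>1. p i = bs" if "bs \<in> L - {[]}" for bs
  proof -
    have "bs \<in> p ` {1..}" using that F unfolding p by (auto simp: basis_tuples_def L_def)
    then show ?thesis by auto
  qed
  then obtain j where j: "\<And>bs. bs \<in> L - {[]} \<Longrightarrow> 1 \<le> j bs \<and> p (j bs) = bs" by metis
  obtain N where N: "\<And>bs. bs \<in> L \<Longrightarrow> j bs \<le> N"
    using \<open>finite L\<close> by (metis finite_imageI finite_nat_set_iff_bounded_le imageI)
  show ?thesis
  proof
    show "(1/2::real) ^ N > 0" by simp
    fix x y assume xy: "x \<in> words D" "y \<in> words D" and less: "word_dist D p x y < (1/2) ^ N"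
    show "agree D F k x y"
    proof (rule ccontr)
      assume "\<not> agree D F k x y"
      then obtain bs where bs: "bs \<in> L" and ne: "(x \<in> cylinder D bs) \<noteq> (y \<in> cylinder D bs)"
        by (auto simp: agree_def L_def)
      \<comment> \<open>The empty list is not enumerated by \<open>p\<close>, but its cylinder is
        all of \<open>words D\<close>, so it separates nothing.\<close>
      have "bs \<noteq> []" using ne xy by auto
      then have jb: "1 \<le> j bs" "p (j bs) = bs" using j bs by auto
      have "(LEAST i. 1 \<le> i \<and> (x \<in> cylinder D (p i)) \<noteq> (y \<in> cylinder D (p i))) \<le> j bs"
        using jb ne by (intro Least_le) auto
      also have "\<dots> \<le> N" using N bs by auto
      finally have "(1/2::real) ^ N \<le> word_dist D p x y"
        using ne by (auto simp: word_dist_def intro!: power_decreasing)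
      then show False using less by simp
    qed
  qed
qed


section \<open>Ultrametric compactifications\<close>

locale ultrametric_compactification =
  fixes X :: "'a topology" and D :: "'a set" and \<B> :: "'a set set"
    and d :: "'a option \<Rightarrow> 'a option \<Rightarrow> real"
  assumes D_subset: "D \<subseteq> topspace X"
    and basis: "compact_open_basis (subtopology X D) \<B>"
    and ultra: "compatible_ultrametric (compactified X D) d"
begin

lemma topspace_compactified: "topspace (compactified X D) = insert None (Some ` D)"
  using D_subset by (auto simp: Int_absorb1)

lemma metric_space: "Metric_space (insert None (Some ` D)) d"
  using ultra unfolding compatible_ultrametric_def topspace_compactified by blast

sublocale cpt: Metric_space "insert None (Some ` D)" d
  by (rule metric_space)

lemma mtopology_eq: "cpt.mtopology = compactified X D"
  using ultra unfolding compatible_ultrametric_def topspace_compactified by blast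

text \<open>The strong triangle inequality in the form in which estimates are chained: the bound
  does not grow.\<close>

lemma ultra_less:
  assumes "x \<in> insert None (Some ` D)" "y \<in> insert None (Some ` D)" "z \<in> insert None (Some ` D)"
    and "d x y < r" "d y z < r"
  shows "d x z < r"
proof -
  have "d x z \<le> max (d x y) (d y z)"
    using ultra assms(1-3) unfolding compatible_ultrametric_def topspace_compactified by blast
  then show ?thesis using assms(4,5) by linarith
qed

lemma basis_subset: "B \<in> \<B> \<Longrightarrow> B \<subseteq> D"
  using basis openin_subset[of "subtopology X D" B] unfolding compact_open_basis_def by auto

lemma openin_Some_basis: "B \<in> \<B> \<Longrightarrow> openin (compactified X D) (Some ` B)"
  using basis unfolding compact_open_basis_def by simp

lemma compactin_Some_basis: "B \<in> \<B> \<Longrightarrow> compactin (compactified X D) (Some ` B)"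
  using basis unfolding compact_open_basis_def
  by (intro image_compactin[OF _ continuous_map_Some]) blast

lemma closedin_Some_basis: "B \<in> \<B> \<Longrightarrow> closedin (compactified X D) (Some ` B)"
  using cpt.Hausdorff_space_mtopology
  by (intro compactin_imp_closedin[OF _ compactin_Some_basis]) (simp_all add: mtopology_eq)

lemma small_basis_set:
  assumes "a \<in> D" "r > 0"
  obtains B where "B \<in> \<B>" "a \<in> B" "Some ` B \<subseteq> cpt.mball (Some a) r"
proof -
  have "openin (subtopology X D) {x \<in> topspace (subtopology X D). Some x \<in> cpt.mball (Some a) r}"
    by (rule openin_continuous_map_preimage[OF continuous_map_Some])
       (metis mtopology_eq cpt.openin_mball)
  moreover have "a \<in> {x \<in> topspace (subtopology X D). Some x \<in> cpt.mball (Some a) r}"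
    using assms D_subset by auto
  ultimately obtain B where "B \<in> \<B>" "a \<in> B"
      "B \<subseteq> {x \<in> topspace (subtopology X D). Some x \<in> cpt.mball (Some a) r}"
    using basis unfolding compact_open_basis_def by meson
  then show ?thesis using that by blast
qed

lemma basis_separates:
  assumes "a \<in> D" "b \<in> D" "a \<noteq> b"
  obtains B where "B \<in> \<B>" "a \<in> B" "b \<notin> B"
proof -
  have "d (Some a) (Some b) > 0" using assms by (intro cpt.mdist_pos_less) auto
  then obtain B where "B \<in> \<B>" "a \<in> B" "Some ` B \<subseteq> cpt.mball (Some a) (d (Some a) (Some b))"
    using small_basis_set assms by metis
  then show ?thesis using that by force
qed

text \<open>A compact open set contains, around each of its points, a ball of one fixed radius.
  Symmetry of \<open>d\<close> gives both directions, and finitely many sets leave a positive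
  minimum.\<close>

lemma near_points_same_sets:
  assumes "finite F" "F \<subseteq> \<B>"
  obtains \<eta> where "\<eta> > 0"
    "\<And>a b B. a \<in> D \<Longrightarrow> b \<in> D \<Longrightarrow> d (Some a) (Some b) < \<eta> \<Longrightarrow> B \<in> F \<Longrightarrow> a \<in> B \<longleftrightarrow> b \<in> B"
proof -
  have "\<exists>\<eta>>0. \<forall>a\<in>D. \<forall>b\<in>D. \<forall>B\<in>F. d (Some a) (Some b) < \<eta> \<longrightarrow> (a \<in> B \<longleftrightarrow> b \<in> B)"
    using assms
  proof (induction F rule: finite_induct)
    case empty
    then show ?case by (auto intro: exI[of _ 1])
  next
    case (insert C F)
    then obtain \<eta> where \<eta>: "\<eta> > 0"
      "\<forall>a\<in>D. \<forall>b\<in>D. \<forall>B\<in>F. d (Some a) (Some b) < \<eta> \<longrightarrow> (a \<in> B \<longleftrightarrow> b \<in> B)"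
      by auto
    have "C \<in> \<B>" using insert by auto
    \<comment> \<open>The radius is a Lebesgue number for the cover of the compact set by itself
      alone.\<close>
    then have "\<exists>\<epsilon>>0. \<forall>x\<in>Some ` C. \<exists>U\<in>{Some ` C}. cpt.mball x \<epsilon> \<subseteq> U"
      using openin_Some_basis compactin_Some_basis
      by (intro cpt.lebesgue_number) (auto simp: mtopology_eq)
    then obtain \<epsilon> where \<epsilon>: "\<epsilon> > 0" "\<forall>x\<in>C. cpt.mball (Some x) \<epsilon> \<subseteq> Some ` C" by auto
    have C: "b \<in> C" if "a \<in> D" "b \<in> D" "d (Some a) (Some b) < \<epsilon>" "a \<in> C" for a b
    proof -
      have "Some b \<in> cpt.mball (Some a) \<epsilon>" using that by auto
      then show ?thesis using \<epsilon> that by blast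
    qed
    have "\<forall>a\<in>D. \<forall>b\<in>D. \<forall>B\<in>insert C F. d (Some a) (Some b) < min \<eta> \<epsilon> \<longrightarrow> (a \<in> B \<longleftrightarrow> b \<in> B)"
      using \<eta> C by (metis cpt.commute insertE min_less_iff_conj)
    then show ?case using \<open>\<eta> > 0\<close> \<open>\<epsilon> > 0\<close> by (metis min_less_iff_conj)
  qed
  then show ?thesis using that by metis
qed

text \<open>By compactness, finitely many small basis sets together with a ball around infinity
  cover everything. Thus a finite part of the basis controls the noncompact \<open>D\<close>:
  whatever it misses is close to infinity.\<close>

lemma fine_partial_cover:
  assumes "\<eta> > 0"
  obtains F where "finite F" "F \<subseteq> \<B>"
    "\<And>a b B. B \<in> F \<Longrightarrow> a \<in> B \<Longrightarrow> b \<in> B \<Longrightarrow> d (Some a) (Some b) < \<eta>"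
    "\<And>a. a \<in> D \<Longrightarrow> (\<And>B. B \<in> F \<Longrightarrow> a \<notin> B) \<Longrightarrow> d None (Some a) < \<eta>"
proof -
  define \<V> where "\<V> = {B \<in> \<B>. \<exists>a\<in>D. Some ` B \<subseteq> cpt.mball (Some a) \<eta>}"
  define \<U> where "\<U> = insert (cpt.mball None \<eta>) ((`) Some ` \<V>)"
  have "\<exists>\<F>. finite \<F> \<and> \<F> \<subseteq> \<U> \<and> \<Union>\<F> = topspace (compactified X D)"
  proof -
    have op: "\<forall>U\<in>\<U>. openin (compactified X D) U"
      using openin_Some_basis cpt.openin_mball by (auto simp: \<U>_def \<V>_def mtopology_eq)
    have "Some a \<in> \<Union>\<U>" if a: "a \<in> D" for a
    proof -
      obtain B where "B \<in> \<B>" "a \<in> B" "Some ` B \<subseteq> cpt.mball (Some a) \<eta>"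
        using small_basis_set a assms by metis
      then show ?thesis using a by (auto simp: \<U>_def \<V>_def)
    qed
    moreover have "None \<in> \<Union>\<U>" using assms by (auto simp: \<U>_def)
    ultimately have "topspace (compactified X D) \<subseteq> \<Union>\<U>"
      unfolding topspace_compactified by blast
    moreover have "\<Union>\<U> \<subseteq> topspace (compactified X D)"
      using op openin_subset by blast
    ultimately show ?thesis
      using op compact_space_Alexandroff_compactification unfolding compact_space by (meson equalityI)
  qed
  then obtain \<F> where \<F>: "finite \<F>" "\<F> \<subseteq> \<U>" "\<Union>\<F> = insert None (Some ` D)"
    unfolding topspace_compactified by blast
  have "\<F> - {cpt.mball None \<eta>} \<subseteq> (`) Some ` \<V>" using \<F> by (auto simp: \<U>_def)
  then obtain F where F: "finite F" "F \<subseteq> \<V>" "\<F> - {cpt.mball None \<eta>} = (`) Some ` F"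
    using \<F>(1) by (meson finite_Diff finite_subset_image)
  show ?thesis
  proof
    show "finite F" "F \<subseteq> \<B>" using F by (auto simp: \<V>_def)
  next
    fix a b B assume "B \<in> F" and ab: "a \<in> B" "b \<in> B"
    then obtain c where c: "c \<in> D" "Some ` B \<subseteq> cpt.mball (Some c) \<eta>"
      using F(2) unfolding \<V>_def by blast
    then have m: "Some a \<in> cpt.mball (Some c) \<eta>" "Some b \<in> cpt.mball (Some c) \<eta>"
      using ab by auto
    then show "d (Some a) (Some b) < \<eta>"
      by - (rule ultra_less[where y="Some c"], auto simp: cpt.commute)
  next
    fix a assume a: "a \<in> D" "\<And>B. B \<in> F \<Longrightarrow> a \<notin> B"
    have "Some a \<in> \<Union>\<F>" using \<F> a by auto
    then obtain U where U: "U \<in> \<F>" "Some a \<in> U" by blast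
    \<comment> \<open>No member of \<open>F\<close> contains \<open>a\<close>, so the covering set
      through \<open>Some a\<close> can only be the ball around infinity.\<close>
    have "U \<notin> (`) Some ` F" using a U by auto
    then have "U = cpt.mball None \<eta>" using U(1) unfolding F(3)[symmetric] by blast
    then show "d None (Some a) < \<eta>" using U by auto
  qed
qed

section \<open>Cylinders determine words and their distances\<close>

lemma not_separated_prefix:
  assumes x: "x \<in> words D" and y: "y \<in> words D"
    and same: "\<And>bs. bs \<in> basis_tuples \<B> \<Longrightarrow> x \<in> cylinder D bs \<longleftrightarrow> y \<in> cylinder D bs"
    and n: "enat n \<le> wlen x"
  shows "enat n \<le> wlen y \<and> (\<forall>i<n. letter y i = letter x i)"
proof (cases "n = 0")
  case True
  then show ?thesis by (simp flip: zero_enat_def)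
next
  case False
  \<comment> \<open>A list of such sets has \<open>x\<close> in its cylinder, hence also
    \<open>y\<close>, and thereby excludes differing letters. While the length of \<open>y\<close>
    is unknown, \<open>letter y i\<close> may be a meaningless value; avoidance is therefore asked
    only for values in \<open>D\<close>.\<close>
  have "\<exists>B\<in>\<B>. letter x i \<in> B \<and> (letter y i \<in> D \<and> letter y i \<noteq> letter x i \<longrightarrow> letter y i \<notin> B)"
    if "i < n" for i
  proof -
    have xi: "letter x i \<in> D"
      using x n that unfolding words_def
      by (metis (mono_tags, lifting) enat_ord_simps(2) mem_Collect_eq order_less_le_trans)
    show ?thesis
    proof (cases "letter y i \<in> D \<and> letter y i \<noteq> letter x i")
      case True
      then show ?thesis using basis_separates xi by metis
    next
      case False
      then show ?thesis using small_basis_set[OF xi zero_less_one] by metis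
    qed
  qed
  then obtain g where g: "\<And>i. i < n \<Longrightarrow> g i \<in> \<B> \<and> letter x i \<in> g i \<and>
      (letter y i \<in> D \<and> letter y i \<noteq> letter x i \<longrightarrow> letter y i \<notin> g i)"
    by metis
  define bs where "bs = map g [0..<n]"
  have "bs \<in> basis_tuples \<B>" using False g by (auto simp: bs_def basis_tuples_def)
  moreover have "x \<in> cylinder D bs" using x n g by (auto simp: bs_def cylinder_def)
  ultimately have y': "y \<in> cylinder D bs" using same by blast
  then have len: "enat n \<le> wlen y" and yg: "\<And>i. i < n \<Longrightarrow> letter y i \<in> g i"
    by (auto simp: cylinder_def bs_def)
  have "letter y i \<in> D" if "i < n" for i
    using y len that unfolding words_def
    by (metis (mono_tags, lifting) enat_ord_simps(2) mem_Collect_eq order_less_le_trans)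
  then show ?thesis using g yg len by blast
qed

lemma cylinders_separate_words:
  assumes "x \<in> words D" "y \<in> words D" "x \<noteq> y"
  shows "\<exists>bs\<in>basis_tuples \<B>. (x \<in> cylinder D bs) \<noteq> (y \<in> cylinder D bs)"
proof (rule ccontr)
  assume "\<not> ?thesis"
  then have same: "x \<in> cylinder D bs \<longleftrightarrow> y \<in> cylinder D bs" if "bs \<in> basis_tuples \<B>" for bs
    using that by blast
  have xy: "enat n \<le> wlen y \<and> (\<forall>i<n. letter y i = letter x i)" if "enat n \<le> wlen x" for n
    using not_separated_prefix[of x y n] assms same that by auto
  have yx: "enat n \<le> wlen x \<and> (\<forall>i<n. letter x i = letter y i)" if "enat n \<le> wlen y" for n
    using not_separated_prefix[of y x n] assms same that by auto
  have "x = y"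
  proof (cases x; cases y)
    fix xs ys assume e: "x = FinW xs" "y = FinW ys"
    show ?thesis using xy[of "length xs"] yx[of "length ys"] e by (auto intro!: nth_equalityI)
  next
    fix xs s assume e: "x = FinW xs" "y = InfW s"
    \<comment> \<open>One letter beyond the end of the finite word: the infinite word has it, the
      finite one does not.\<close>
    show ?thesis using yx[of "Suc (length xs)"] e by auto
  next
    fix xs s assume e: "x = InfW s" "y = FinW xs"
    show ?thesis using xy[of "Suc (length xs)"] e by auto
  next
    fix s t assume e: "x = InfW s" "y = InfW t"
    have "s i = t i" for i using xy[of "Suc i"] e by auto
    then show ?thesis using e by auto
  qed
  then show False using assms by blast
qed

text \<open>Converse of \<open>agree_of_word_dist_less\<close>: the sets and lengths of the first
  \<open>N\<close> tuples are collected in \<open>F\<close> and \<open>k\<close>, so agreement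
  pushes the first separating index beyond \<open>N\<close>.\<close>

lemma word_dist_less_of_agree:
  assumes p: "p ` {1..} = basis_tuples \<B>" and "\<epsilon> > 0"
  obtains F k where "finite F" "F \<subseteq> \<B>"
    "\<And>x y. x \<in> words D \<Longrightarrow> y \<in> words D \<Longrightarrow> agree D F k x y \<Longrightarrow> word_dist D p x y < \<epsilon>"
proof -
  obtain N where N: "(1/2::real) ^ N < \<epsilon>"
    using real_arch_pow_inv[of \<epsilon> "1/2"] assms by auto
  define F where "F = (\<Union>i\<in>{1..N}. set (p i))"
  define k where "k = (\<Sum>i\<in>{1..N}. length (p i))"
  have pB: "p i \<in> basis_tuples \<B>" if "1 \<le> i" for i
    using that p by auto
  have len: "length (p i) \<le> k" if "i \<in> {1..N}" for i
    unfolding k_def using that by (intro member_le_sum) auto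
  show ?thesis
  proof
    show "finite F" by (auto simp: F_def)
    show "F \<subseteq> \<B>" using pB by (fastforce simp: F_def basis_tuples_def)
    fix x y assume xy: "x \<in> words D" "y \<in> words D" and ag: "agree D F k x y"
    show "word_dist D p x y < \<epsilon>"
    proof (cases "x = y")
      case True
      then show ?thesis using assms by (simp add: word_dist_def)
    next
      case False
      let ?P = "\<lambda>i. 1 \<le> i \<and> (x \<in> cylinder D (p i)) \<noteq> (y \<in> cylinder D (p i))"
      \<comment> \<open>Distinct words have a separating index, so the \<open>LEAST\<close> in the
        distance is attained.\<close>
      obtain bs where bs: "bs \<in> basis_tuples \<B>" "(x \<in> cylinder D bs) \<noteq> (y \<in> cylinder D bs)"
        using cylinders_separate_words xy False by metis
      have "bs \<in> p ` {1..}" using bs p by simp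
      then have "\<exists>i. ?P i" using bs by auto
      then have P: "?P (LEAST i. ?P i)" by (rule LeastI_ex)
      have "\<not> ?P i" if "i \<le> N" for i
        using ag len[of i] that unfolding agree_def F_def by fastforce
      then have "N < (LEAST i. ?P i)" using P by (meson not_le)
      then have "(1/2::real) ^ (LEAST i. ?P i) \<le> (1/2) ^ N"
        by (intro power_decreasing) auto
      moreover have "word_dist D p x y = (1/2) ^ (LEAST i. ?P i)"
        using False by (simp add: word_dist_def)
      ultimately show ?thesis using N by linarith
    qed
  qed
qed

section \<open>Cylinders are clopen in the quotient topology\<close>

lemma trunc_in_cylinder_iff:
  assumes "u \<in> topspace (cpt_seqs X D)" "set bs \<subseteq> \<B>"
  shows "trunc u \<in> cylinder D bs \<longleftrightarrow> (\<forall>i<length bs. u i \<in> Some ` (bs ! i))"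
proof -
  have w: "trunc u \<in> words D" using assms trunc_image_cpt_seqs[OF D_subset] by blast
  show ?thesis
  proof (cases "\<forall>i. u i \<noteq> None")
    case True
    then have "trunc u = InfW (\<lambda>i. the (u i))" by (simp add: trunc_def)
    moreover have "the (u i) \<in> S \<longleftrightarrow> u i \<in> Some ` S" for i S using True[rule_format, of i] by force
    ultimately show ?thesis using w by (simp add: cylinder_InfW)
  next
    case False
    define m where "m = (LEAST n. u n = None)"
    have um: "u m = None" unfolding m_def using False by (metis (mono_tags, lifting) LeastI)
    have ui: "u i \<noteq> None" if "i < m" for i using that not_less_Least unfolding m_def by blast
    have t: "trunc u = FinW (map (\<lambda>i. the (u i)) [0..<m])"
      using False unfolding trunc_def m_def by metis
    have e: "the (u i) \<in> S \<longleftrightarrow> u i \<in> Some ` S" if "i < m" for i S using ui[OF that] by force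
    have "trunc u \<in> cylinder D bs \<longleftrightarrow> length bs \<le> m \<and> (\<forall>i<length bs. the (u i) \<in> bs ! i)"
      using w unfolding t cylinder_def by auto
    also have "\<dots> \<longleftrightarrow> (\<forall>i<length bs. u i \<in> Some ` (bs ! i))"
    proof (cases "length bs \<le> m")
      case True
      then show ?thesis using e by (meson order_less_le_trans)
    next
      case False
      \<comment> \<open>A list longer than the truncated word also tests the coordinate
        \<open>m\<close>, which is infinity and fails.\<close>
      then have "u m \<notin> Some ` (bs ! m)" "m < length bs" using um by auto
      then show ?thesis using False by blast
    qed
    finally show ?thesis .
  qed
qed

text \<open>The preimage under \<open>trunc\<close> is a box that restricts finitely many
  coordinates to clopen sets; the complement is a finite union of conditions on single
  coordinates.\<close>

lemma openin_cylinder: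
  assumes "set bs \<subseteq> \<B>"
  shows "openin (word_top X D) (cylinder D bs)" "openin (word_top X D) (words D - cylinder D bs)"
proof -
  let ?T = "cpt_seqs X D"
  have c: "continuous_map ?T (compactified X D) (\<lambda>u. u i)" for i
    unfolding cpt_seqs_def by (rule continuous_map_product_projection) simp
  have b: "bs ! i \<in> \<B>" if "i < length bs" for i using that assms by auto
  have o: "openin ?T {u \<in> topspace ?T. u i \<in> Some ` (bs ! i)}" if "i < length bs" for i
    using openin_continuous_map_preimage[OF c openin_Some_basis[OF b[OF that]]] .
  have o': "openin ?T {u \<in> topspace ?T. u i \<in> topspace (compactified X D) - Some ` (bs ! i)}"
    if "i < length bs" for i
    using openin_continuous_map_preimage[OF c openin_diff[OF openin_topspace
          closedin_Some_basis[OF b[OF that]]]] .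
  have "{u \<in> topspace ?T. trunc u \<in> cylinder D bs} =
      topspace ?T \<inter> (\<Inter>i\<in>{..<length bs}. {u \<in> topspace ?T. u i \<in> Some ` (bs ! i)})"
    using trunc_in_cylinder_iff[OF _ assms] by auto
  moreover have "openin ?T \<dots>"
  proof (cases "bs = []")
    case False
    then show ?thesis using o by (intro openin_Int openin_INT2) auto
  qed auto
  ultimately show "openin (word_top X D) (cylinder D bs)"
    unfolding openin_word_top trunc_image_cpt_seqs[OF D_subset]
    using cylinder_subset_words by metis
  have "{u \<in> topspace ?T. trunc u \<in> words D - cylinder D bs} =
     (\<Union>i\<in>{..<length bs}. {u \<in> topspace ?T. u i \<in> topspace (compactified X D) - Some ` (bs ! i)})"
  proof -
    have "trunc u \<in> words D" if "u \<in> topspace ?T" for u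
      using that trunc_image_cpt_seqs[OF D_subset] by blast
    moreover have "u i \<in> topspace (compactified X D)" if "u \<in> topspace ?T" for u i
      using c[of i] that unfolding continuous_map_def by blast
    ultimately show ?thesis
      unfolding set_eq_iff mem_Collect_eq UN_iff Diff_iff lessThan_iff
      using trunc_in_cylinder_iff[OF _ assms] by blast
  qed
  moreover have "openin ?T \<dots>" using o' by blast
  ultimately show "openin (word_top X D) (words D - cylinder D bs)"
    unfolding openin_word_top trunc_image_cpt_seqs[OF D_subset] by (metis Diff_subset)
qed

text \<open>Each cylinder is clopen, so it eventually treats \<open>s n\<close> as it treats the
  limit; there are finitely many lists, so one index serves them all.\<close>

lemma limit_agree:
  assumes "limitin (word_top X D) s x sequentially" "finite F" "F \<subseteq> \<B>"
  obtains n where "agree D F k (s n) x"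
proof -
  define L where "L = {bs. set bs \<subseteq> F \<and> length bs \<le> k}"
  have "finite L" using assms finite_lists_length_le unfolding L_def by blast
  have x: "x \<in> words D"
    using assms(1) topspace_word_top[OF D_subset] by (auto simp: limitin_def)
  have "\<forall>\<^sub>F n in sequentially. s n \<in> cylinder D bs \<longleftrightarrow> x \<in> cylinder D bs" if "bs \<in> L" for bs
  proof -
    have bs: "set bs \<subseteq> \<B>" using that assms by (auto simp: L_def)
    show ?thesis
    proof (cases "x \<in> cylinder D bs")
      case True
      then have "\<forall>\<^sub>F n in sequentially. s n \<in> cylinder D bs"
        using assms(1) openin_cylinder(1)[OF bs] unfolding limitin_def by blast
      then show ?thesis using True by simp
    next
      case False
      then have "\<forall>\<^sub>F n in sequentially. s n \<in> words D - cylinder D bs"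
        using assms(1) x openin_cylinder(2)[OF bs] unfolding limitin_def by blast
      then show ?thesis using False by (auto elim: eventually_mono)
    qed
  qed
  then have "\<forall>\<^sub>F n in sequentially. \<forall>bs\<in>L. s n \<in> cylinder D bs \<longleftrightarrow> x \<in> cylinder D bs"
    using \<open>finite L\<close> by (simp add: eventually_ball_finite)
  then obtain n where "\<forall>bs\<in>L. s n \<in> cylinder D bs \<longleftrightarrow> x \<in> cylinder D bs"
    using eventually_happens' sequentially_bot by blast
  then show ?thesis using that by (auto simp: agree_def L_def)
qed

end

section \<open>Contracting inverse branches\<close>

text \<open>\<open>branch\<close> condenses the separation property: a preimage of \<open>u\<close>
  can be found no farther from \<open>c\<close> than \<open>u\<close> is from the image of
  \<open>c\<close>. That image may be infinity, which allows points mapped there to be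
  moved.\<close>

locale contracting_system = ultrametric_compactification +
  fixes f :: "'a \<Rightarrow> 'a" and R :: real
  assumes onto: "D \<subseteq> f ` D"
    and nil_in_E: "FinW [] \<in> E_space X D f"
    and R_pos: "R > 0"
    and branch: "\<And>c u. c \<in> D \<Longrightarrow> u \<in> insert None (Some ` D) \<Longrightarrow> d (on_cpt D f (Some c)) u < R \<Longrightarrow>
      \<exists>c'\<in>D. on_cpt D f (Some c') = u \<and> d (Some c) (Some c') \<le> d (on_cpt D f (Some c)) u"
begin

section \<open>Infinite backward paths and the words of \<open>E\<close>\<close>

definition bpath :: "(nat \<Rightarrow> 'a) \<Rightarrow> bool" where
  "bpath s \<longleftrightarrow> (\<forall>i. s i \<in> D \<and> f (s (Suc i)) = s i)"

lemma D_infty_iff: "x \<in> D_infty D f \<longleftrightarrow> (\<exists>s. x = InfW s \<and> bpath s)"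
  by (cases x) (auto simp: D_infty_def backward_path_def bpath_def)

lemma InfW_bpath_in_words: "bpath s \<Longrightarrow> InfW s \<in> words D"
  by (auto simp: bpath_def)

lemma bpath_case_nat: "bpath s \<Longrightarrow> f (s 0) \<in> D \<Longrightarrow> bpath (case_nat (f (s 0)) s)"
  by (auto simp: bpath_def split: nat.split)

lemma alpha_InfW: "alpha f (InfW s) = InfW (case_nat (f (s 0)) s)"
  by (simp add: alpha_def)

lemma wtl_alpha [simp]: "wtl (alpha f y) = y"
  by (cases y) (auto simp: alpha_def)

lemma letter_alpha [simp]: "letter (alpha f y) 0 = f (letter y 0)"
  by (cases y) (auto simp: alpha_def)

lemma alpha_nonempty [simp]: "alpha f y \<noteq> FinW []"
  by (cases y) (auto simp: alpha_def)

lemma alpha_in_words: "y \<in> words D \<Longrightarrow> f (letter y 0) \<in> D \<Longrightarrow> alpha f y \<in> words D"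
  by (cases y) (auto simp: alpha_def split: nat.split)

lemma InfW_in_E:
  assumes "bpath s" "f (s 0) \<in> D"
  shows "InfW s \<in> E_space X D f"
proof -
  have "InfW (case_nat (f (s 0)) s) \<in> dom_shift X D f"
    using bpath_case_nat[OF assms] D_infty_iff
    by (auto simp: dom_shift_def X_tilde_def one_enat_def)
  moreover have "InfW s = wtl (InfW (case_nat (f (s 0)) s))" by simp
  ultimately show ?thesis unfolding E_space_def by blast
qed

lemma X_tilde_subset: "X_tilde X D f \<subseteq> words D"
  using InfW_bpath_in_words by (auto simp: X_tilde_def D_lim_def D_fin_def D_infty_def)

lemma E_subset_words: "E_space X D f \<subseteq> words D"
  using X_tilde_subset wtl_in_words by (fastforce simp: E_space_def dom_shift_def)

text \<open>The word is the tail of a path in \<open>X_tilde\<close>, and the letter deleted from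
  that path is the image of its head. Hence first letters of words in \<open>E\<close> are never
  sent to infinity.\<close>

lemma E_head:
  assumes "y \<in> E_space X D f" "y \<noteq> FinW []"
  shows "letter y 0 \<in> D" "f (letter y 0) \<in> D"
proof -
  show "letter y 0 \<in> D" using assms E_subset_words letter_0_in by blast
  obtain x where x: "x \<in> X_tilde X D f" "1 \<le> wlen x" "y = wtl x"
    using assms by (auto simp: E_space_def dom_shift_def)
  have "x \<noteq> FinW []" using x by (simp add: wlen_ge_1_iff)
  then have "backward_path f x" using x(1)
    by (auto simp: X_tilde_def D_infty_def D_lim_def D_fin_def)
  \<comment> \<open>A nonempty tail forces \<open>x\<close> to have at least two letters.\<close>
  moreover have "enat (Suc 0) < wlen x" "letter y 0 = letter x (Suc 0)"
    using x(3) assms(2) by (cases x; auto simp: nth_tl neq_Nil_conv; case_tac x1; auto)+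
  ultimately have "f (letter y 0) = letter x 0" by (simp add: backward_path_def)
  then show "f (letter y 0) \<in> D"
    using x X_tilde_subset \<open>x \<noteq> FinW []\<close> letter_0_in by (metis subsetD)
qed

section \<open>Approximation of words by infinite paths\<close>

lemma D_lim_approx:
  assumes "x \<in> D_lim X D f" "finite F" "F \<subseteq> \<B>"
  obtains s where "bpath s" "agree D F k (InfW s) x"
proof -
  obtain \<sigma> where \<sigma>: "\<forall>n. \<sigma> n \<in> D_infty D f" "limitin (word_top X D) \<sigma> x sequentially"
    using assms(1) unfolding D_lim_def by blast
  obtain n where "agree D F k (\<sigma> n) x" using limit_agree[OF \<sigma>(2) assms(2,3)] .
  then show ?thesis using \<sigma>(1) D_infty_iff that by metis
qed

text \<open>The word is approximated one letter deeper and the first letter is dropped. A basis set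
  around that letter is added to \<open>F\<close>, since agreement passes to tails only below a head
  that is seen.\<close>

lemma D_lim_wtl_approx:
  assumes "x \<in> D_lim X D f" "x \<noteq> FinW []" "finite F" "F \<subseteq> \<B>"
  obtains s where "bpath s" "agree D F k (InfW s) (wtl x)"
proof -
  have x: "x \<in> words D" using assms X_tilde_subset by (auto simp: X_tilde_def)
  obtain B where B: "B \<in> \<B>" "letter x 0 \<in> B"
    using letter_0_in[OF x assms(2)] small_basis_set zero_less_one by metis
  obtain s where s: "bpath s" "agree D (insert B F) (Suc k) (InfW s) x"
    using D_lim_approx[OF assms(1)] assms B by (metis finite_insert insert_subset)
  have "agree D (insert B F) k (wtl x) (wtl (InfW s))"
    using agree_wtl[OF agree_sym[OF s(2)] x assms(2) insertI1 B(2)] .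
  then have "agree D F k (InfW (\<lambda>i. s (Suc i))) (wtl x)"
    using agree_mono[OF agree_sym] by fastforce
  moreover have "bpath (\<lambda>i. s (Suc i))" using s(1) by (simp add: bpath_def)
  ultimately show ?thesis using that by blast
qed

text \<open>Serves to replace a possibly finite word by an infinite path, along which pullbacks can
  run forever.\<close>

lemma E_approx:
  assumes "y \<in> E_space X D f" "finite F" "F \<subseteq> \<B>"
  obtains s where "bpath s" "agree D F k (InfW s) y"
proof -
  obtain x where x: "x \<in> X_tilde X D f" "x \<noteq> FinW []" "y = wtl x"
    using assms by (auto simp: E_space_def dom_shift_def wlen_ge_1_iff)
  show ?thesis
  proof (cases "x \<in> D_infty D f")
    case True
    then obtain s where s: "x = InfW s" "bpath s" using D_infty_iff by blast
    have "bpath (\<lambda>i. s (Suc i))" using s(2) by (simp add: bpath_def)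
    moreover have "agree D F k (InfW (\<lambda>i. s (Suc i))) y" using s x by (simp add: agree_def)
    ultimately show ?thesis using that by blast
  next
    case False
    then have "x \<in> D_lim X D f" using x by (simp add: X_tilde_def)
    then show ?thesis using D_lim_wtl_approx[OF _ x(2) assms(2,3)] x(3) that by metis
  qed
qed

text \<open>Either both heads lie in one small member of \<open>G\<close>, or \<open>G\<close>
  misses both; then both are near infinity and, by the strong triangle inequality, near each
  other.\<close>

lemma heads_close:
  assumes "\<eta> > 0"
  obtains G where "finite G" "G \<subseteq> \<B>"
    "\<And>k x y. x \<in> words D \<Longrightarrow> y \<in> words D \<Longrightarrow> x \<noteq> FinW [] \<Longrightarrow> y \<noteq> FinW [] \<Longrightarrow>
       agree D G (Suc k) x y \<Longrightarrow> d (Some (letter x 0)) (Some (letter y 0)) < \<eta>"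
proof -
  obtain G where G: "finite G" "G \<subseteq> \<B>"
    and same: "\<And>a b B. B \<in> G \<Longrightarrow> a \<in> B \<Longrightarrow> b \<in> B \<Longrightarrow> d (Some a) (Some b) < \<eta>"
    and none: "\<And>a. a \<in> D \<Longrightarrow> (\<And>B. B \<in> G \<Longrightarrow> a \<notin> B) \<Longrightarrow> d None (Some a) < \<eta>"
    using fine_partial_cover[OF assms] by metis
  have "d (Some (letter x 0)) (Some (letter y 0)) < \<eta>"
    if xy: "x \<in> words D" "y \<in> words D" "x \<noteq> FinW []" "y \<noteq> FinW []"
      and ag: "agree D G (Suc k) x y" for k x y
  proof (cases "\<exists>B\<in>G. letter x 0 \<in> B")
    case True
    then obtain B where B: "B \<in> G" "letter x 0 \<in> B" by blast
    then have "letter y 0 \<in> B" using agree_nonempty_iff[OF ag xy(1,3)] by blast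
    then show ?thesis using same[OF B] by blast
  next
    case False
    then have F: "letter x 0 \<notin> B" "letter y 0 \<notin> B" if "B \<in> G" for B
      using agree_nonempty_iff[OF agree_sym[OF ag] xy(2,4)] that by blast+
    have D: "letter x 0 \<in> D" "letter y 0 \<in> D" using xy letter_0_in by blast+
    have "d (Some (letter x 0)) None < \<eta>" "d None (Some (letter y 0)) < \<eta>"
      using none[OF D(1) F(1)] none[OF D(2) F(2)] by (simp_all add: cpt.commute)
    then show ?thesis using D by - (rule ultra_less[where y=None], auto)
  qed
  then show ?thesis using that G by metis
qed

text \<open>Where \<^prop>\<open>FinW [] \<in> E_space X D f\<close> is used: it says that infinity is not isolated.\<close>

lemma near_None:
  assumes "\<eta> > 0"
  obtains v where "v \<in> D" "d None (Some v) < \<eta>"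
proof -
  obtain F where F: "finite F" "F \<subseteq> \<B>"
    and none: "\<And>a. a \<in> D \<Longrightarrow> (\<And>B. B \<in> F \<Longrightarrow> a \<notin> B) \<Longrightarrow> d None (Some a) < \<eta>"
    using fine_partial_cover[OF assms] by metis
  obtain x where x: "x \<in> X_tilde X D f" "x \<noteq> FinW []" "FinW [] = wtl x"
    using nil_in_E by (auto simp: E_space_def dom_shift_def wlen_ge_1_iff)
  \<comment> \<open>A path with empty tail is finite, hence a limit of infinite paths. Their tails
    agree with the empty word on \<open>F\<close>, so the first letters of these tails escape
    \<open>F\<close>.\<close>
  have "x \<notin> D_infty D f" using x(3) by (auto simp: D_infty_iff)
  then have "x \<in> D_lim X D f" using x by (simp add: X_tilde_def)
  then obtain s where s: "bpath s" "agree D F (Suc 0) (InfW s) (FinW [])"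
    using D_lim_wtl_approx[OF _ x(2) F] x(3) by metis
  have "s 0 \<notin> B" if "B \<in> F" for B
    using agree_nonempty_iff[OF s(2) InfW_bpath_in_words[OF s(1)] _ that] by auto
  then show ?thesis using that none s(1) by (auto simp: bpath_def)
qed

lemma near_D:
  assumes "u \<in> insert None (Some ` D)" "\<eta> > 0"
  shows "\<exists>v\<in>D. d u (Some v) < \<eta>"
proof (cases u)
  case None
  then show ?thesis using near_None assms by metis
next
  case (Some v)
  then show ?thesis using assms by (intro bexI[of _ v]) auto
qed

section \<open>Orbits and pullbacks along paths\<close>

lemma on_cpt_eq_SomeD: "on_cpt D f (Some c) = Some b \<Longrightarrow> f c = b \<and> b \<in> D"
  by (auto simp: on_cpt_def to_cpt_def split: if_splits)

lemma on_cpt_Some: "f c \<in> D \<Longrightarrow> on_cpt D f (Some c) = Some (f c)"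
  by (auto simp: on_cpt_def to_cpt_def)

lemma on_cpt_in: "on_cpt D f (Some c) \<in> insert None (Some ` D)"
  by (auto simp: on_cpt_def to_cpt_def)

lemma bpath_from:
  assumes "a \<in> D"
  obtains t where "bpath t" "t 0 = a"
proof -
  have "\<exists>t. \<forall>n. (t n \<in> D \<and> (n = 0 \<longrightarrow> t n = a)) \<and> f (t (Suc n)) = t n"
    using assms onto by (intro dependent_nat_choice) auto
  then show ?thesis using that unfolding bpath_def by blast
qed

text \<open>The letters are chosen recursively by \<open>branch\<close> at \<open>s (Suc n)\<close>
  with target \<open>t n\<close>. The distance never exceeds its initial value, so it stays below
  \<open>R\<close> and \<open>branch\<close> applies at every step.\<close>

lemma bpath_pullback:
  assumes s: "bpath s" and b: "b \<in> D" and close: "d (Some (s 0)) (Some b) < R"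
  obtains t where "bpath t" "t 0 = b"
    "\<And>i. d (Some (s i)) (Some (t i)) \<le> d (Some (s 0)) (Some b)"
proof -
  let ?\<rho> = "d (Some (s 0)) (Some b)"
  have "\<exists>t. \<forall>n. (t n \<in> D \<and> d (Some (s n)) (Some (t n)) \<le> ?\<rho> \<and> (n = 0 \<longrightarrow> t n = b)) \<and>
      f (t (Suc n)) = t n"
  proof (rule dependent_nat_choice)
    show "\<exists>x. x \<in> D \<and> d (Some (s 0)) (Some x) \<le> ?\<rho> \<and> (0 = (0::nat) \<longrightarrow> x = b)"
      using b by blast
    fix x n assume x: "x \<in> D \<and> d (Some (s n)) (Some x) \<le> ?\<rho> \<and> (n = 0 \<longrightarrow> x = b)"
    have sn: "s (Suc n) \<in> D" "on_cpt D f (Some (s (Suc n))) = Some (s n)"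
      using s on_cpt_Some unfolding bpath_def by metis+
    obtain c where "c \<in> D" "on_cpt D f (Some c) = Some x"
      "d (Some (s (Suc n))) (Some c) \<le> d (Some (s n)) (Some x)"
      using branch[OF sn(1), of "Some x"] x close unfolding sn(2) by auto
    then show "\<exists>y. (y \<in> D \<and> d (Some (s (Suc n))) (Some y) \<le> ?\<rho> \<and> (Suc n = 0 \<longrightarrow> y = b)) \<and> f y = x"
      using x on_cpt_eq_SomeD by force
  qed
  then show ?thesis using that unfolding bpath_def by metis
qed

lemma funpow_on_cpt:
  assumes "\<And>j. j \<le> n \<Longrightarrow> (f ^^ j) b \<in> D"
  shows "(on_cpt D f ^^ n) (Some b) = Some ((f ^^ n) b)"
  using assms
proof (induction n)
  case (Suc n)
  then show ?case using on_cpt_Some[of "(f ^^ n) b"] Suc.prems[of "Suc n"] by simp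
qed simp

lemma funpow_in_D:
  assumes "\<And>n. (on_cpt D f ^^ n) (Some b) \<in> Some ` D"
  shows "(f ^^ n) b \<in> D \<and> (on_cpt D f ^^ n) (Some b) = Some ((f ^^ n) b)"
proof (induction n)
  case 0
  then show ?case using assms[of 0] by auto
next
  case (Suc n)
  then show ?case using assms[of "Suc n"] on_cpt_eq_SomeD[of "(f ^^ n) b"] by auto
qed

lemma letter_funpow_alpha: "letter ((alpha f ^^ n) z) 0 = (f ^^ n) (letter z 0)"
  by (induction n) auto

lemma funpow_alpha_bpath:
  assumes "bpath t" "\<And>n. (f ^^ n) (t 0) \<in> D"
  shows "\<exists>t'. (alpha f ^^ n) (InfW t) = InfW t' \<and> bpath t' \<and> t' 0 = (f ^^ n) (t 0)"
proof (induction n)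
  case (Suc n)
  then obtain t' where t': "(alpha f ^^ n) (InfW t) = InfW t'" "bpath t'" "t' 0 = (f ^^ n) (t 0)"
    by blast
  then show ?case
    using bpath_case_nat[OF t'(2)] assms(2)[of "Suc n"] by (auto simp: alpha_InfW)
qed (use assms in auto)


section \<open>Transfer of shadowing\<close>

context
  fixes p :: "nat \<Rightarrow> 'a set list"
  assumes p: "p ` {1..} = basis_tuples \<B>"
begin

lemma shadowing_E_if_shadowing_cpt:
  assumes sh: "shadowing_property (insert None (Some ` D)) (Some ` D) (on_cpt D f) d"
  shows "shadowing_property (E_space X D f) (E_space X D f - {FinW []}) (alpha f) (word_dist D p)"
    (is "shadowing_property ?E ?A _ _")
  unfolding shadowing_property_def
proof (intro allI impI)
  fix \<epsilon> :: real assume "\<epsilon> > 0"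
  obtain F k where F: "finite F" "F \<subseteq> \<B>"
    and wd: "\<And>x y. x \<in> words D \<Longrightarrow> y \<in> words D \<Longrightarrow> agree D F k x y \<Longrightarrow> word_dist D p x y < \<epsilon>"
    using word_dist_less_of_agree[OF p \<open>\<epsilon> > 0\<close>] by metis
  obtain \<eta> where \<eta>: "\<eta> > 0" and near: "\<And>a b B. a \<in> D \<Longrightarrow> b \<in> D \<Longrightarrow> d (Some a) (Some b) < \<eta> \<Longrightarrow>
      B \<in> F \<Longrightarrow> a \<in> B \<longleftrightarrow> b \<in> B"
    using near_points_same_sets[OF F] by metis
  \<comment> \<open>Below \<open>\<eta>\<close>, letters lie in the same sets of \<open>F\<close>;
    below \<open>R\<close>, paths can be pulled back.\<close>
  define e where "e = min \<eta> R"
  have e: "e > 0" "e \<le> \<eta>" "e \<le> R" using \<eta> R_pos by (auto simp: e_def)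
  obtain \<delta>' where \<delta>': "\<delta>' > 0" and sh': "\<And>x. pseudo_orbit (Some ` D) (on_cpt D f) d \<delta>' x \<Longrightarrow>
      \<exists>z\<in>Some ` D. shadows (insert None (Some ` D)) (Some ` D) (on_cpt D f) d e z x"
    using sh \<open>e > 0\<close> unfolding shadowing_property_def by metis
  obtain G1 where G1: "finite G1" "G1 \<subseteq> \<B>" and hc1: "\<And>k x y. x \<in> words D \<Longrightarrow> y \<in> words D \<Longrightarrow>
      x \<noteq> FinW [] \<Longrightarrow> y \<noteq> FinW [] \<Longrightarrow> agree D G1 (Suc k) x y \<Longrightarrow>
      d (Some (letter x 0)) (Some (letter y 0)) < e"
    using heads_close[OF \<open>e > 0\<close>] by metis
  obtain G2 where G2: "finite G2" "G2 \<subseteq> \<B>" and hc2: "\<And>k x y. x \<in> words D \<Longrightarrow> y \<in> words D \<Longrightarrow>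
      x \<noteq> FinW [] \<Longrightarrow> y \<noteq> FinW [] \<Longrightarrow> agree D G2 (Suc k) x y \<Longrightarrow>
      d (Some (letter x 0)) (Some (letter y 0)) < \<delta>'"
    using heads_close[OF \<open>\<delta>' > 0\<close>] by metis
  \<comment> \<open>\<open>G2\<close> makes the heads a \<delta>'-pseudo-orbit, \<open>F\<close>
    keeps the memory of earlier words. Depth \<open>Suc k\<close> is positive even for
    \<open>k = 0\<close>, so heads are always compared.\<close>
  obtain \<delta> where \<delta>: "\<delta> > 0" and ag: "\<And>x y. x \<in> words D \<Longrightarrow> y \<in> words D \<Longrightarrow>
      word_dist D p x y < \<delta> \<Longrightarrow> agree D (F \<union> G2) (Suc k) x y"
    using agree_of_word_dist_less[OF p, of "F \<union> G2" D "Suc k"] F G2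
    by (metis finite_Un Un_least)
  have "\<exists>z\<in>?A. shadows ?E ?A (alpha f) (word_dist D p) \<epsilon> z x"
    if po: "pseudo_orbit ?A (alpha f) (word_dist D p) \<delta> x" for x
  proof -
    define a where "a n = letter (x n) 0" for n
    have xE: "x n \<in> ?E" and xne: "x n \<noteq> FinW []"
      and xd: "word_dist D p (alpha f (x n)) (x (Suc n)) < \<delta>" for n
      using po by (auto simp: pseudo_orbit_def)
    have aD: "a n \<in> D" and faD: "f (a n) \<in> D" for n
      using E_head[OF xE xne] by (auto simp: a_def)
    have xw: "x n \<in> words D" for n using xE E_subset_words by blast
    have axw: "alpha f (x n) \<in> words D" for n
      using alpha_in_words[OF xw] faD by (simp add: a_def)
    have step: "agree D (F \<union> G2) (Suc k) (alpha f (x n)) (x (Suc n))" for n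
      using ag[OF axw xw xd] .
    have "agree D G2 (Suc k) (alpha f (x n)) (x (Suc n))" for n
      using agree_mono[OF step] by simp
    then have "d (Some (f (a n))) (Some (a (Suc n))) < \<delta>'" for n
      using hc2[OF axw xw alpha_nonempty xne] unfolding a_def letter_alpha by blast
    then have "pseudo_orbit (Some ` D) (on_cpt D f) d \<delta>' (\<lambda>n. Some (a n))"
      using aD faD by (auto simp: pseudo_orbit_def on_cpt_Some)
    from sh'[OF this] obtain b where "shadows (insert None (Some ` D)) (Some ` D) (on_cpt D f) d e (Some b)
        (\<lambda>n. Some (a n))"
      by blast
    then have sb: "(on_cpt D f ^^ n) (Some b) \<in> Some ` D"
        "d ((on_cpt D f ^^ n) (Some b)) (Some (a n)) < e" for n
      by (auto simp: shadows_def dom_power_def)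
    have bD: "(f ^^ n) b \<in> D" and bd: "d (Some ((f ^^ n) b)) (Some (a n)) < e" for n
      using funpow_in_D[of b n] sb by metis+
    \<comment> \<open>\<open>x 0\<close> may be finite. The path \<open>s\<close> replaces it:
      \<open>F\<close> keeps the words in agreement, and \<open>G1\<close> brings \<open>s 0\<close>
      close enough to \<open>b\<close> for a pullback.\<close>
    obtain s where s: "bpath s" "agree D (F \<union> G1) (Suc k) (InfW s) (x 0)"
      using E_approx[OF xE] F G1 by (metis finite_Un Un_least)
    have s0: "s 0 \<in> D" using s(1) by (simp add: bpath_def)
    have "agree D G1 (Suc k) (InfW s) (x 0)" using agree_mono[OF s(2)] by simp
    then have "d (Some (letter (InfW s) 0)) (Some (letter (x 0) 0)) < e"
      by - (rule hc1[OF InfW_bpath_in_words[OF s(1)] xw _ xne], simp)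
    then have "d (Some (s 0)) (Some (a 0)) < e" by (simp add: a_def)
    then have sb0: "d (Some (s 0)) (Some b) < e"
      using bd[of 0] bD[of 0] aD s0
      by - (rule ultra_less[where y="Some (a 0)"], auto simp: cpt.commute)
    then obtain t where t: "bpath t" "t 0 = b"
        and tc: "\<And>i. d (Some (s i)) (Some (t i)) \<le> d (Some (s 0)) (Some b)"
      using bpath_pullback[OF s(1), of b] bD[of 0] e by auto
    \<comment> \<open>The first letter is the shadowing point \<open>b\<close>, and every letter is
      within \<open>e\<close> of the corresponding letter of \<open>s\<close>.\<close>
    define z where "z = InfW t"
    have zn: "\<exists>t'. (alpha f ^^ n) z = InfW t' \<and> bpath t' \<and> t' 0 = (f ^^ n) b" for n
      using funpow_alpha_bpath[OF t(1)] bD t(2) by (auto simp: z_def)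
    have zA: "(alpha f ^^ n) z \<in> ?A" for n
    proof -
      obtain t' where t': "(alpha f ^^ n) z = InfW t'" "bpath t'" "t' 0 = (f ^^ n) b"
        using zn by blast
      \<comment> \<open>Membership in \<open>E\<close> requires the image of the head to lie in
        \<open>D\<close>, hence the iterate \<open>Suc n\<close>.\<close>
      then show ?thesis using InfW_in_E[OF t'(2)] bD[of "Suc n"] by auto
    qed
    have zw: "(alpha f ^^ n) z \<in> words D" for n using zA E_subset_words by blast
    have zh: "letter ((alpha f ^^ n) z) 0 = (f ^^ n) b" for n
      using t(2) by (simp add: letter_funpow_alpha z_def)
    have "agree D F (Suc k) z (InfW s)"
      unfolding z_def
    proof (rule agree_InfW)
      fix i
      show i: "t i \<in> D" "s i \<in> D" using t s by (auto simp: bpath_def)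
      have "d (Some (t i)) (Some (s i)) < \<eta>" using tc[of i] sb0 e by (simp add: cpt.commute)
      then show "t i \<in> B \<longleftrightarrow> s i \<in> B" if "B \<in> F" for B using near i that by blast
    qed
    then have start: "agree D F (Suc k) z (x 0)"
      using agree_trans agree_mono[OF s(2)] by (metis Un_upper1 order_refl)
    \<comment> \<open>Induction on the depth, for all \<open>n\<close> at once. The heads agree by
      shadowing of first letters; the tails are compared with the previous words at depth one less.
      At \<open>n = 0\<close> the choice of \<open>z\<close> takes over.\<close>
    have "agree D F j ((alpha f ^^ n) z) (x n)" if "j \<le> k" for j n
      using that
    proof (induction j arbitrary: n)
      case 0
      then show ?case using agree_0 zw xw by blast
    next
      case (Suc j)
      show ?case
      proof (cases n)
        case 0
        then show ?thesis using agree_mono[OF start] Suc.prems by auto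
      next
        case (Suc m)
        show ?thesis
        proof (rule agree_Suc_I[OF zw xw _ xne])
          show "(alpha f ^^ n) z \<noteq> FinW []" using zA by blast
          fix B assume "B \<in> F"
          then show "letter ((alpha f ^^ n) z) 0 \<in> B \<longleftrightarrow> letter (x n) 0 \<in> B"
            using near[OF bD aD, of n n] bd[of n] e by (auto simp: zh a_def)
          assume B: "letter (x n) 0 \<in> B"
          \<comment> \<open>The tail of \<open>alpha f (x m)\<close> is \<open>x m\<close> itself,
            so the tail of \<open>x n\<close> agrees with \<open>x m\<close> to depth
            \<open>j\<close>.\<close>
          have "agree D F (Suc j) (x n) (alpha f (x m))"
            using agree_mono[OF agree_sym[OF step]] Suc Suc.prems by auto
          from agree_wtl[OF this xw xne \<open>B \<in> F\<close> B]
          have "agree D F j (x m) (wtl (x n))" using agree_sym by simp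
          moreover have "agree D F j ((alpha f ^^ m) z) (x m)" using Suc.IH Suc.prems by simp
          ultimately show "agree D F j (wtl ((alpha f ^^ n) z)) (wtl (x n))"
            using Suc agree_trans by simp
        qed
      qed
    qed
    then have "word_dist D p ((alpha f ^^ n) z) (x n) < \<epsilon>" for n
      using wd[OF zw xw] by blast
    then have "shadows ?E ?A (alpha f) (word_dist D p) \<epsilon> z x"
      using zA zA[of 0] by (auto simp: shadows_def dom_power_def)
    then show ?thesis using zA[of 0] by auto
  qed
  then show "\<exists>\<delta>>0. \<forall>x. pseudo_orbit ?A (alpha f) (word_dist D p) \<delta> x \<longrightarrow>
      (\<exists>z\<in>?A. shadows ?E ?A (alpha f) (word_dist D p) \<epsilon> z x)"
    using \<delta> by blast
qed

text \<open>At the end only heads are compared, so depth one is enough for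
  \<open>\<epsilon>'\<close>. The depth \<open>k\<close> belonging to \<open>\<delta>\<close>
  governs how the lifted words must follow one another.\<close>

lemma shadowing_cpt_if_shadowing_E:
  assumes sh: "shadowing_property (E_space X D f) (E_space X D f - {FinW []}) (alpha f)
    (word_dist D p)"
  shows "shadowing_property (insert None (Some ` D)) (Some ` D) (on_cpt D f) d"
    (is "shadowing_property ?K ?S _ _")
  unfolding shadowing_property_def
proof (intro allI impI)
  let ?E = "E_space X D f" and ?A = "E_space X D f - {FinW []}"
  fix \<epsilon> :: real assume "\<epsilon> > 0"
  obtain G where G: "finite G" "G \<subseteq> \<B>" and hc: "\<And>k x y. x \<in> words D \<Longrightarrow> y \<in> words D \<Longrightarrow>
      x \<noteq> FinW [] \<Longrightarrow> y \<noteq> FinW [] \<Longrightarrow> agree D G (Suc k) x y \<Longrightarrow>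
      d (Some (letter x 0)) (Some (letter y 0)) < \<epsilon>"
    using heads_close[OF \<open>\<epsilon> > 0\<close>] by metis
  obtain \<epsilon>' where \<epsilon>': "\<epsilon>' > 0" and ag: "\<And>x y. x \<in> words D \<Longrightarrow> y \<in> words D \<Longrightarrow>
      word_dist D p x y < \<epsilon>' \<Longrightarrow> agree D G (Suc 0) x y"
    using agree_of_word_dist_less[OF p G] by metis
  obtain \<delta> where \<delta>: "\<delta> > 0" and sh': "\<And>x. pseudo_orbit ?A (alpha f) (word_dist D p) \<delta> x \<Longrightarrow>
      \<exists>z\<in>?A. shadows ?E ?A (alpha f) (word_dist D p) \<epsilon>' z x"
    using sh \<open>\<epsilon>' > 0\<close> unfolding shadowing_property_def by metis
  obtain F k where F: "finite F" "F \<subseteq> \<B>"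
    and wd: "\<And>x y. x \<in> words D \<Longrightarrow> y \<in> words D \<Longrightarrow> agree D F k x y \<Longrightarrow> word_dist D p x y < \<delta>"
    using word_dist_less_of_agree[OF p \<open>\<delta> > 0\<close>] by metis
  obtain \<eta> where \<eta>: "\<eta> > 0" and near: "\<And>a b B. a \<in> D \<Longrightarrow> b \<in> D \<Longrightarrow> d (Some a) (Some b) < \<eta> \<Longrightarrow>
      B \<in> F \<Longrightarrow> a \<in> B \<longleftrightarrow> b \<in> B"
    using near_points_same_sets[OF F] by metis
  define \<delta>' where "\<delta>' = min \<eta> R"
  have \<delta>': "\<delta>' > 0" "\<delta>' \<le> \<eta>" "\<delta>' \<le> R" using \<eta> R_pos by (auto simp: \<delta>'_def)
  have "\<exists>z\<in>?S. shadows ?K ?S (on_cpt D f) d \<epsilon> z x"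
    if po: "pseudo_orbit ?S (on_cpt D f) d \<delta>' x" for x
  proof -
    have "\<forall>n. \<exists>c. x n = Some c \<and> c \<in> D" using po by (auto simp: pseudo_orbit_def)
    then obtain c where c: "\<And>n. x n = Some (c n)" "\<And>n. c n \<in> D" by metis
    have cd: "d (on_cpt D f (Some (c n))) (Some (c (Suc n))) < \<delta>'" for n
      using po c by (simp add: pseudo_orbit_def)
    \<comment> \<open>Moving points by less than \<open>e\<close> preserves both the pseudo-orbit
      bound \<open>\<delta>'\<close> and the final bound \<open>\<epsilon>\<close>, because the
      metric is an ultrametric.\<close>
    define e where "e = min \<delta>' \<epsilon>"
    have e: "e > 0" "e \<le> \<delta>'" "e \<le> \<epsilon>" using \<delta>' \<open>\<epsilon> > 0\<close> by (auto simp: e_def)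
    txt \<open>Points of the pseudo-orbit that \<open>f\<close> sends to infinity are not first letters of words
      in \<open>E\<close>, so they are moved slightly.\<close>
    have "\<exists>a\<in>D. f a \<in> D \<and> d (Some (c n)) (Some a) < e \<and>
        d (on_cpt D f (Some (c n))) (Some (f a)) < e" for n
    proof -
      \<comment> \<open>The image, possibly infinity, is first replaced by a nearby point of
        \<open>D\<close>; \<open>branch\<close> then supplies a preimage of it near
        \<open>c n\<close>.\<close>
      obtain v where v: "v \<in> D" "d (on_cpt D f (Some (c n))) (Some v) < e"
        using near_D[OF on_cpt_in e(1)] by metis
      then obtain a where "a \<in> D" "on_cpt D f (Some a) = Some v"
          "d (Some (c n)) (Some a) \<le> d (on_cpt D f (Some (c n))) (Some v)"
        using branch[OF c(2)[of n], of "Some v"] e \<delta>' by auto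
      then show ?thesis using v on_cpt_eq_SomeD by force
    qed
    then obtain a where aD: "\<And>n. a n \<in> D" and faD: "\<And>n. f (a n) \<in> D"
      and ca: "\<And>n. d (Some (c n)) (Some (a n)) < e"
      and cfa: "\<And>n. d (on_cpt D f (Some (c n))) (Some (f (a n))) < e"
      by metis
    have fa: "d (Some (f (a n))) (Some (a (Suc n))) < \<delta>'" for n
    proof -
      have "d (Some (f (a n))) (Some (c (Suc n))) < \<delta>'"
        using cfa[of n] cd[of n] e on_cpt_in c faD
        by - (rule ultra_less[where y="on_cpt D f (Some (c n))"], auto simp: cpt.commute)
      then show ?thesis
        using ca[of "Suc n"] e aD c faD by - (rule ultra_less[where y="Some (c (Suc n))"], auto)
    qed
    \<comment> \<open>\<open>S (Suc n)\<close> is the pullback, starting at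
      \<open>a (Suc n)\<close>, along the image of \<open>S n\<close> under \<open>alpha\<close>.
      All letters are controlled simultaneously, so consecutive words agree at every depth.\<close>
    have "\<exists>S. \<forall>n. (bpath (S n) \<and> S n 0 = a n) \<and>
        (\<forall>i. d (Some (case_nat (f (a n)) (S n) i)) (Some (S (Suc n) i)) < \<delta>')"
    proof (rule dependent_nat_choice)
      show "\<exists>s. bpath s \<and> s 0 = a 0" using bpath_from[OF aD] by metis
      fix s n assume s: "bpath s \<and> s 0 = a n"
      then have "bpath (case_nat (f (a n)) s)" using bpath_case_nat[of s] faD by simp
      then obtain t where "bpath t" "t 0 = a (Suc n)"
          "\<And>i. d (Some (case_nat (f (a n)) s i)) (Some (t i)) \<le> d (Some (f (a n))) (Some (a (Suc n)))"
        using bpath_pullback[of "case_nat (f (a n)) s" "a (Suc n)"] aD fa[of n] \<delta>' by auto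
      then show "\<exists>t. (bpath t \<and> t 0 = a (Suc n)) \<and>
          (\<forall>i. d (Some (case_nat (f (a n)) s i)) (Some (t i)) < \<delta>')"
        using fa[of n] by (meson order_le_less_trans)
    qed
    then obtain S where S: "\<And>n. bpath (S n)" "\<And>n. S n 0 = a n"
      and Sc: "\<And>n i. d (Some (case_nat (f (a n)) (S n) i)) (Some (S (Suc n) i)) < \<delta>'"
      by metis
    have aS: "alpha f (InfW (S n)) = InfW (case_nat (f (a n)) (S n))" for n
      by (simp add: alpha_InfW S)
    have bS: "bpath (case_nat (f (a n)) (S n))" for n
      using bpath_case_nat[OF S(1)[of n]] S(2) faD by simp
    have "agree D F k (alpha f (InfW (S n))) (InfW (S (Suc n)))" for n
      unfolding aS
    proof (rule agree_InfW)
      fix i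
      show i: "case_nat (f (a n)) (S n) i \<in> D" "S (Suc n) i \<in> D"
        using bS[of n] S(1)[of "Suc n"] unfolding bpath_def by blast+
      show "case_nat (f (a n)) (S n) i \<in> B \<longleftrightarrow> S (Suc n) i \<in> B" if "B \<in> F" for B
        using near[OF i _ that] Sc[of n i] \<delta>' by linarith
    qed
    then have "word_dist D p (alpha f (InfW (S n))) (InfW (S (Suc n))) < \<delta>" for n
      using wd InfW_bpath_in_words[OF bS] InfW_bpath_in_words[OF S(1)] by (metis aS)
    moreover have SA: "InfW (S n) \<in> ?A" for n
      using InfW_in_E[OF S(1)] S(2) faD by auto
    ultimately have "pseudo_orbit ?A (alpha f) (word_dist D p) \<delta> (\<lambda>n. InfW (S n))"
      by (auto simp: pseudo_orbit_def)
    from sh'[OF this] obtain z where z: "shadows ?E ?A (alpha f) (word_dist D p) \<epsilon>' z (\<lambda>n. InfW (S n))"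
      by blast
    then have zA: "(alpha f ^^ n) z \<in> ?A"
        and zd: "word_dist D p ((alpha f ^^ n) z) (InfW (S n)) < \<epsilon>'" for n
      unfolding shadows_def dom_power_def by blast+
    have zw: "(alpha f ^^ n) z \<in> words D" for n using zA E_subset_words by blast
    define b where "b = letter z 0"
    have zh: "letter ((alpha f ^^ n) z) 0 = (f ^^ n) b" for n
      by (simp add: letter_funpow_alpha b_def)
    have bD: "(f ^^ n) b \<in> D" for n using E_head(1)[of "(alpha f ^^ n) z"] zA zh by auto
    have "d (Some ((f ^^ n) b)) (Some (a n)) < \<epsilon>" for n
    proof -
      have "agree D G (Suc 0) ((alpha f ^^ n) z) (InfW (S n))"
        using ag[OF zw InfW_bpath_in_words[OF S(1)] zd] .
      then have "d (Some (letter ((alpha f ^^ n) z) 0)) (Some (letter (InfW (S n)) 0)) < \<epsilon>"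
        using zA by (intro hc[OF zw InfW_bpath_in_words[OF S(1)]]) auto
      then show ?thesis by (simp add: zh S)
    qed
    then have "d (Some ((f ^^ n) b)) (Some (c n)) < \<epsilon>" for n
      using ca[of n] e aD bD c by - (rule ultra_less[where y="Some (a n)"], auto simp: cpt.commute)
    then have "shadows ?K ?S (on_cpt D f) d \<epsilon> (Some b) x"
      using bD bD[of 0] c by (auto simp: shadows_def dom_power_def funpow_on_cpt)
    then show ?thesis using bD[of 0] by auto
  qed
  then show "\<exists>\<delta>>0. \<forall>x. pseudo_orbit ?S (on_cpt D f) d \<delta> x \<longrightarrow>
      (\<exists>z\<in>?S. shadows ?K ?S (on_cpt D f) d \<epsilon> z x)"
    using \<delta>' by blast
qed

end

end

text \<open>For \<open>W r\<close> containing \<open>c\<close>, the ball condition puts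
  \<open>u\<close> into the image of \<open>W r\<close>, where the inverse branch is defined. Its
  contraction estimate at the image of \<open>c\<close> and at \<open>u\<close> gives the bound, as
  \<open>\<theta> < 1\<close>.\<close>

lemma separation_property_branches:
  assumes "ultrametric_compactification X D \<B> d" "separation_property X D f \<B> d"
  obtains R where "R > 0"
    "\<And>c u. c \<in> D \<Longrightarrow> u \<in> insert None (Some ` D) \<Longrightarrow> d (on_cpt D f (Some c)) u < R \<Longrightarrow>
      \<exists>c'\<in>D. on_cpt D f (Some c') = u \<and> d (Some c) (Some c') \<le> d (on_cpt D f (Some c)) u"
proof -
  interpret ultrametric_compactification X D \<B> d by fact
  obtain R \<theta> W where R: "R > 0" and \<theta>: "0 < \<theta>" "\<theta> < 1" and W: "\<And>r::nat. W r \<in> \<B>"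
    and cov: "D \<subseteq> (\<Union>r. W r)"
    and hom: "\<And>r. homeomorphic_map (subtopology X (W r)) (subtopology X (f ` W r)) f"
    and emb: "\<And>r. subspace_of_cpt X D (f ` W r)"
    and contr: "\<And>r a b. a \<in> on_cpt D f ` Some ` W r \<Longrightarrow> b \<in> on_cpt D f ` Some ` W r \<Longrightarrow>
        d (inv_into (Some ` W r) (on_cpt D f) a) (inv_into (Some ` W r) (on_cpt D f) b) \<le> \<theta> * d a b"
    and ball: "\<And>r y. y \<in> on_cpt D f ` Some ` W r \<Longrightarrow>
        Metric_space.mball (topspace (compactified X D)) d y R \<subseteq> on_cpt D f ` Some ` W r"
    using assms(2) unfolding separation_property_def Let_def by metis
  have "\<exists>c'\<in>D. on_cpt D f (Some c') = u \<and> d (Some c) (Some c') \<le> d (on_cpt D f (Some c)) u"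
    if c: "c \<in> D" and u: "u \<in> insert None (Some ` D)" and less: "d (on_cpt D f (Some c)) u < R"
    for c u
  proof -
    obtain r where r: "c \<in> W r" using cov c by blast
    let ?F = "on_cpt D f" and ?S = "Some ` W r"
    have WX: "W r \<subseteq> topspace X" using W basis_subset D_subset by blast
    have "inj_on f (W r)"
      using homeomorphic_imp_injective_map[OF hom[of r]] WX by (simp add: Int_absorb1)
    moreover have "inj_on (to_cpt D) (f ` W r)"
    proof -
      have "f ` W r \<subseteq> topspace X"
        using equalityD1[OF homeomorphic_imp_surjective_map[OF hom[of r],
              unfolded topspace_subtopology]]
        by (simp only: Int_subset_iff Int_absorb1[OF WX])
      moreover have "inj_on (to_cpt D) (topspace (subtopology X (f ` W r)))"
        by (rule homeomorphic_imp_injective_map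
              [OF emb[of r, unfolded subspace_of_cpt_def embedding_map_def]])
      ultimately show ?thesis by (simp only: topspace_subtopology_subset)
    qed
    ultimately have inj: "inj_on ?F ?S"
      by (auto simp: inj_on_def on_cpt_def)
    have Fc: "?F (Some c) \<in> ?F ` ?S" using r by blast
    have "?F (Some c) \<in> insert None (Some ` D)" by (auto simp: on_cpt_def to_cpt_def)
    then have "u \<in> cpt.mball (?F (Some c)) R" using u less by simp
    then have uF: "u \<in> ?F ` ?S" using ball[OF Fc] unfolding topspace_compactified by blast
    let ?g = "inv_into ?S ?F"
    obtain c' where c': "c' \<in> W r" "?g u = Some c'" using inv_into_into[OF uF] by auto
    have "?F (Some c') = u" using f_inv_into_f[OF uF] c' by simp
    \<comment> \<open>By injectivity the preimage chosen by \<open>inv_into\<close> is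
      \<open>c\<close> itself, so the contraction estimate speaks about \<open>c\<close>.\<close>
    moreover have "?g (?F (Some c)) = Some c" using inv_into_f_f[OF inj] r by blast
    then have "d (Some c) (Some c') \<le> \<theta> * d (?F (Some c)) u"
      using contr[OF Fc uF] c' by simp
    moreover have "\<theta> * d (?F (Some c)) u \<le> d (?F (Some c)) u"
      using \<theta> by (simp add: mult_left_le_one_le)
    moreover have "c' \<in> D" using c' W basis_subset by blast
    ultimately show ?thesis by force
  qed
  then show ?thesis using that R by blast
qed

theorem theorem5p5:
  fixes X :: "'a topology" and D :: "'a set" and f :: "'a \<Rightarrow> 'a"
    and \<B> :: "'a set set" and p :: "nat \<Rightarrow> 'a set list"
    and d_inf :: "'a option \<Rightarrow> 'a option \<Rightarrow> real"
  assumes "deaconu_renault X D f"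
    and "infinite D"
    and "compact_open_basis (subtopology X D) \<B>"
    and "p ` {1..} = basis_tuples \<B>"
    and "D \<subseteq> f ` D"
    and "subspace_of_cpt X D (f ` D)"
    and "FinW [] \<in> E_space X D f"
    and "compatible_ultrametric (compactified X D) d_inf"
    and "separation_property X D f \<B> d_inf"
  shows "shadowing_property (E_space X D f) (E_space X D f - {FinW []}) (alpha f) (word_dist D p)
     \<longleftrightarrow> shadowing_property (topspace (compactified X D)) (Some ` D) (on_cpt D f) d_inf"
proof -
  have "D \<subseteq> topspace X" using assms(1) openin_subset by (auto simp: deaconu_renault_def)
  then have uc: "ultrametric_compactification X D \<B> d_inf"
    using assms(3,8) by (rule ultrametric_compactification.intro)
  obtain R where R: "R > 0"
    "\<And>c u. c \<in> D \<Longrightarrow> u \<in> insert None (Some ` D) \<Longrightarrow> d_inf (on_cpt D f (Some c)) u < R \<Longrightarrow>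
      \<exists>c'\<in>D. on_cpt D f (Some c') = u \<and>
        d_inf (Some c) (Some c') \<le> d_inf (on_cpt D f (Some c)) u"
    using separation_property_branches[OF uc assms(9)] by metis
  interpret contracting_system X D \<B> d_inf f R
    by (rule contracting_system.intro[OF uc
          contracting_system_axioms.intro[OF assms(5,7) R]])
  show ?thesis
    using shadowing_E_if_shadowing_cpt[OF assms(4)] shadowing_cpt_if_shadowing_E[OF assms(4)]
    unfolding topspace_compactified by blast
qed

end
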